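(* Let $p_1,\ldots,p_n\in\mathbb B$ be $n$ distinct points, no three of which belong to the same $2$-sphere (that is, no three of which are mutually equivalent), and let $s_1,\ldots,s_n\in\mathbb H$. Then there exists exactly one function $S\in\mathcal R(\mathbb B,\overline{\mathbb B})$ such that $S(p_i)=s_i$ for $i=1,\ldots,n$ if and only if the Pick matrix $$P=\left[\sum_{k=0}^\infty p_i^k(1-s_i\bar s_j)\bar p_j^k\right]_{i,j=1}^n$$ is positive semidefinite and singular.
   Context: $\mathbb H$ is the algebra of real quaternions, $\mathbb B=\{p\in\mathbb H:|p|<1\}$, $\overline{\mathbb B}$ its closure, and $\mathbb S$ is the unit sphere of purely imaginary quaternions; for $I\in\mathbb S$, $\mathbb C_I=\{x+Iy:x,y\in\mathbb R\}$. Two quaternions $p,q$ are equivalent if $p=h^{-1}qh$ for some nonzero $h\in\mathbb H$, equivalently if $\mathrm{Re}\,p=\mathrm{Re}\,q$ and $|\mathrm{Im}\,p|=|\mathrm{Im}\,q|$; the equivalence class $[p]$ of $p$ is called a $2$-sphere. For $\Omega\subset\mathbb H$ open, a real differentiable function $f:\Omega\to\mathbb H$ is (left) slice regular on $\Omega$ if for every $I\in\mathbb S$ its restriction $f_I$ to $\Omega\cap\mathbb C_I$ satisfies $\frac{\partial}{\partial x}f_I(x+Iy)+I\frac{\partial}{\partial y}f_I(x+Iy)\equiv0$. The functions slice regular on $\mathbb B$ are exactly the power series $f(p)=\sum_{k\ge0}p^kf_k$, $f_k\in\mathbb H$, with radius of convergence at least one. $\mathcal R(\mathbb B,\overline{\mathbb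 B})$ is the set of functions $f$ slice regular on $\mathbb B$ with $|f(p)|\le1$ for all $p\in\mathbb B$. Positive semidefiniteness of quaternionic matrices is defined as over $\mathbb C$: a Hermitian matrix $A$ is positive semidefinite if $c^*Ac\ge0$ for all column vectors $c$ over $\mathbb H$; singular means not invertible. *)

theory Defs
  imports "HOL-Analysis.Analysis"
begin

section \<open>Real quaternions\<close>

text \<open>\<open>Quat a b c d\<close> is the quaternion $a + bi + cj + dk$.\<close>

codatatype quat = Quat (qre: real) (qi: real) (qj: real) (qk: real)

lemma quat_eq_iff: "x = y \<longleftrightarrow> qre x = qre y \<and> qi x = qi y \<and> qj x = qj y \<and> qk x = qk y"
  by (auto intro: quat.expand)

instantiation quat :: real_vector
begin

primcorec zero_quat where
  "qre 0 = 0"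
| "qi 0 = 0"
| "qj 0 = 0"
| "qk 0 = 0"

primcorec plus_quat where
  "qre (x + y) = qre x + qre y"
| "qi (x + y) = qi x + qi y"
| "qj (x + y) = qj x + qj y"
| "qk (x + y) = qk x + qk y"

primcorec uminus_quat where
  "qre (- x) = - qre x"
| "qi (- x) = - qi x"
| "qj (- x) = - qj x"
| "qk (- x) = - qk x"

primcorec minus_quat where
  "qre (x - y) = qre x - qre y"
| "qi (x - y) = qi x - qi y"
| "qj (x - y) = qj x - qj y"
| "qk (x - y) = qk x - qk y"

primcorec scaleR_quat where
  "qre (scaleR r x) = r * qre x"
| "qi (scaleR r x) = r * qi x"
| "qj (scaleR r x) = r * qj x"
| "qk (scaleR r x) = r * qk x"

instance
  by standard (simp_all add: quat_eq_iff algebra_simps)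

end

instantiation quat :: ring_1
begin

primcorec one_quat where
  "qre 1 = 1"
| "qi 1 = 0"
| "qj 1 = 0"
| "qk 1 = 0"

primcorec times_quat where
  "qre (x * y) = qre x * qre y - qi x * qi y - qj x * qj y - qk x * qk y"
| "qi (x * y) = qre x * qi y + qi x * qre y + qj x * qk y - qk x * qj y"
| "qj (x * y) = qre x * qj y - qi x * qk y + qj x * qre y + qk x * qi y"
| "qk (x * y) = qre x * qk y + qi x * qj y - qj x * qi y + qk x * qre y"

instance
  by standard (simp_all add: quat_eq_iff algebra_simps)

end

instantiation quat :: real_inner
begin

definition inner_quat :: "quat \<Rightarrow> quat \<Rightarrow> real" where
  "inner_quat x y = qre x * qre y + qi x * qi y + qj x * qj y + qk x * qk y"

definition norm_quat :: "quat \<Rightarrow> real" where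
  "norm_quat x = sqrt (inner x x)"

definition sgn_quat :: "quat \<Rightarrow> quat" where
  "sgn_quat x = x /\<^sub>R norm x"

definition dist_quat :: "quat \<Rightarrow> quat \<Rightarrow> real" where
  "dist_quat x y = norm (x - y)"

definition uniformity_quat :: "(quat \<times> quat) filter" where
  "uniformity_quat = (INF e\<in>{0<..}. principal {(x, y). dist x y < e})"

definition open_quat :: "quat set \<Rightarrow> bool" where
  "open_quat U \<longleftrightarrow> (\<forall>x\<in>U. \<forall>\<^sub>F (x', y) in uniformity. x' = x \<longrightarrow> y \<in> U)"

instance
proof
  fix x y z :: quat and r :: real
  show "inner x y = inner y x"
    by (simp add: inner_quat_def algebra_simps)
  show "inner (x + y) z = inner x z + inner y z" "inner (scaleR r x) y = r * inner x y"
    by (simp_all add: inner_quat_def algebra_simps)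
  show "0 \<le> inner x x"
    by (simp add: inner_quat_def)
  show "inner x x = 0 \<longleftrightarrow> x = 0"
    by (simp add: inner_quat_def quat_eq_iff add_nonneg_eq_0_iff)
  show "norm x = sqrt (inner x x)"
    by (rule norm_quat_def)
qed (simp_all add: sgn_quat_def dist_quat_def uniformity_quat_def open_quat_def)

end

primcorec qcnj :: "quat \<Rightarrow> quat" where
  "qre (qcnj x) = qre x"
| "qi (qcnj x) = - qi x"
| "qj (qcnj x) = - qj x"
| "qk (qcnj x) = - qk x"

lemma quat_times_qcnj: "x * qcnj x = inner x x *\<^sub>R 1" "qcnj x * x = inner x x *\<^sub>R 1"
  by (simp_all add: quat_eq_iff inner_quat_def)

instantiation quat :: real_normed_div_algebra
begin

definition inverse_quat :: "quat \<Rightarrow> quat" where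
  "inverse_quat x = qcnj x /\<^sub>R inner x x"

definition divide_quat :: "quat \<Rightarrow> quat \<Rightarrow> quat" where
  "divide_quat x y = x * inverse y"

instance
proof
  fix x y :: quat and r :: real
  show scaleR_l: "scaleR r x * y = scaleR r (x * y)" for r and x y :: quat
    by (simp add: quat_eq_iff algebra_simps)
  show scaleR_r: "x * scaleR r y = scaleR r (x * y)" for r and x y :: quat
    by (simp add: quat_eq_iff algebra_simps)
  show "x \<noteq> 0 \<Longrightarrow> inverse x * x = 1" "x \<noteq> 0 \<Longrightarrow> x * inverse x = 1"
    by (simp_all add: inverse_quat_def scaleR_l scaleR_r quat_times_qcnj)
  show "inverse (0::quat) = 0"
    by (simp add: inverse_quat_def)
  show "x div y = x * inverse y"
    by (rule divide_quat_def)
  have "inner (x * y) (x * y) = inner x x * inner y y"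
    by (simp add: inner_quat_def algebra_simps)
  then show "norm (x * y) = norm x * norm y"
    by (simp add: norm_quat_def real_sqrt_mult)
qed

end

instantiation quat :: euclidean_space
begin

definition Basis_quat :: "quat set" where
  "Basis_quat = {Quat 1 0 0 0, Quat 0 1 0 0, Quat 0 0 1 0, Quat 0 0 0 1}"

instance
proof
  fix u v x :: quat
  show "(Basis :: quat set) \<noteq> {}" "finite (Basis :: quat set)"
    by (simp_all add: Basis_quat_def)
  show "u \<in> Basis \<Longrightarrow> v \<in> Basis \<Longrightarrow> inner u v = (if u = v then 1 else 0)"
    unfolding Basis_quat_def by (elim insertE emptyE) (simp_all add: inner_quat_def)
  show "(\<forall>u\<in>Basis. inner x u = 0) \<longleftrightarrow> x = 0"
    by (simp add: Basis_quat_def inner_quat_def quat_eq_iff [of x])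
qed

end

definition quat_equiv :: "quat \<Rightarrow> quat \<Rightarrow> bool" where
  "quat_equiv p q \<longleftrightarrow> (\<exists>h. h \<noteq> 0 \<and> p = inverse h * q * h)"

definition two_sphere :: "quat \<Rightarrow> quat set" where
  "two_sphere q = {p. quat_equiv p q}"

definition imag_unit_sphere :: "quat set" where
  "imag_unit_sphere = {I. qre I = 0 \<and> norm I = 1}"


section \<open>Slice regular functions\<close>

text \<open>For \<open>f\<close> differentiable on the open set \<open>\<Omega>\<close>, the two \<^const>\<open>vector_derivative\<close>s below
  are the partial derivatives $\partial f_I/\partial x$ and $\partial f_I/\partial y$ at $x + Iy$.\<close>

definition slice_regular_on :: "(quat \<Rightarrow> quat) \<Rightarrow> quat set \<Rightarrow> bool" where
  "slice_regular_on f \<Omega> \<longleftrightarrow> open \<Omega> \<and> f differentiable_on \<Omega> \<and>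
     (\<forall>I\<in>imag_unit_sphere. \<forall>x y. of_real x + I * of_real y \<in> \<Omega> \<longrightarrow>
        vector_derivative (\<lambda>t. f (of_real t + I * of_real y)) (at x)
        + I * vector_derivative (\<lambda>t. f (of_real x + I * of_real t)) (at y) = 0)"

text \<open>The class $\mathcal R(\mathbb B,\overline{\mathbb B})$. Its elements are extensional
  (\<^const>\<open>undefined\<close> off the ball), so that equality in this set is equality of
  functions on $\mathbb B$ and unique existence has its intended meaning.\<close>

definition slice_schur_class :: "(quat \<Rightarrow> quat) set" where
  "slice_schur_class = {f \<in> ball 0 1 \<rightarrow>\<^sub>E cball 0 1. slice_regular_on f (ball 0 1)}"


section \<open>Quaternionic matrices\<close>

definition psd_quat_matrix :: "quat ^ 'n ^ 'n \<Rightarrow> bool" where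
  "psd_quat_matrix A \<longleftrightarrow> (\<forall>i j. A $ i $ j = qcnj (A $ j $ i)) \<and>
     (\<forall>c :: quat ^ 'n. (\<Sum>i\<in>UNIV. qcnj (c $ i) * (A *v c) $ i) \<in> \<real>\<^sub>\<ge>\<^sub>0)"

definition pick_matrix :: "('n \<Rightarrow> quat) \<Rightarrow> ('n \<Rightarrow> quat) \<Rightarrow> quat ^ 'n ^ 'n" where
  "pick_matrix p s = (\<chi> i j. \<Sum>k. p i ^ k * (1 - s i * qcnj (s j)) * qcnj (p j) ^ k)"

end

theory Submission
  imports Defs "HOL-Complex_Analysis.Cauchy_Integral_Formula"
begin

text \<open>A slice regular function \<open>S\<close> on the unit ball is a power series \<open>\<Sum>p\<^sup>k a\<^sub>k\<close>. If it is bounded by one,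
  then star multiplication by \<open>S\<close>, that is the lower triangular Toeplitz operator \<open>T\<close> with entries
  \<open>a\<^sub>k\<close>, is a contraction on square summable sequences of quaternions
  (\<open>schur_star_product_contractive\<close>). Its adjoint multiplies the sequence of powers of the
  conjugate of \<open>p\<close> by the conjugate of \<open>S(p)\<close>. Hence, for a column \<open>c\<close>, it sends the sequence
  \<open>f\<^sub>k = \<Sum>\<^sub>j cnj(p\<^sub>j)\<^sup>k c\<^sub>j\<close> to \<open>g\<^sub>k = \<Sum>\<^sub>j cnj(s\<^sub>j) cnj(p\<^sub>j)\<^sup>k c\<^sub>j\<close> whenever \<open>S\<close> solves the interpolation problem.
  The Pick matrix \<open>P\<close> measures the loss of norm: \<open>c\<^sup>* P c = \<parallel>f\<parallel>\<^sup>2 - \<parallel>g\<parallel>\<^sup>2\<close>. So a solution forces \<open>P\<close> to be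
  positive semidefinite (\<open>node_norm_le\<close>).

  Suppose \<open>c\<^sup>* P c = 0\<close> with \<open>c \<noteq> 0\<close>. The contraction \<open>T\<^sup>*\<close> then preserves the norm of \<open>f\<close>, and this gives
  \<open>T g = f\<close> (\<open>star_product_node_seq\<close>). Here \<open>f\<close> and \<open>g\<close> are known from the data, and \<open>g\<close> is not zero
  because at most two nodes lie on each sphere (\<open>node_seq_eq_0_imp\<close>). The convolution equation
  \<open>T g = f\<close> determines the coefficients of \<open>S\<close> one after the other, so \<open>S\<close> is unique.

  For existence, a positive semidefinite \<open>P\<close> is factored as \<open>X X\<^sup>*\<close>. The Stein identity
  \<open>P\<^sub>i\<^sub>j + s\<^sub>i cnj(s\<^sub>j) = 1 + p\<^sub>i P\<^sub>i\<^sub>j cnj(p\<^sub>j)\<close> says that the rows \<open>(p\<^sub>i X\<^sub>i, 1)\<close> and \<open>(X\<^sub>i, s\<^sub>i)\<close> have the same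
  Gram matrix. A left linear contraction maps the former to the latter, and the transfer function of
  this contraction is a solution (\<open>contractive_realization\<close>).

  It remains to see that an invertible positive semidefinite \<open>P\<close> has several solutions. Such a \<open>P\<close> is
  definite, so it stays semidefinite when the values \<open>s\<^sub>i\<close> are replaced by \<open>t s\<^sub>i\<close> with some \<open>t > 1\<close>.
  A solution for these values, divided by \<open>t\<close>, solves the original problem and is bounded by \<open>1 / t\<close>.
  This leaves room to add a small multiple of a polynomial that vanishes at all nodes
  (\<open>strict_pick_not_unique\<close>).\<close>

section \<open>Quaternions and complex slices\<close>

lemma quat_of_real_sel [simp]:
  "qre (of_real r) = r" "qi (of_real r) = 0" "qj (of_real r) = 0" "qk (of_real r) = 0"
  by (simp_all add: of_real_def)

lemma qcnj_simps [simp]: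
  "qcnj (x * y) = qcnj y * qcnj x" "qcnj (x + y) = qcnj x + qcnj y"
  "qcnj (x - y) = qcnj x - qcnj y" "qcnj (- x) = - qcnj x" "qcnj (qcnj x) = x"
  "qcnj 0 = 0" "qcnj 1 = 1" "qcnj (of_real r) = of_real r" "qcnj (r *\<^sub>R x) = r *\<^sub>R qcnj x"
  by (simp_all add: quat_eq_iff)

lemma qcnj_power [simp]: "qcnj (x ^ n) = qcnj x ^ n"
  by (induction n) (simp_all add: power_commutes)

lemma qcnj_sum: "qcnj (sum f A) = (\<Sum>x\<in>A. qcnj (f x))"
  by (induction A rule: infinite_finite_induct) simp_all

lemma norm_qcnj [simp]: "norm (qcnj x) = norm x"
  by (simp add: norm_quat_def inner_quat_def)

lemma qcnj_eq_0_iff [simp]: "qcnj x = 0 \<longleftrightarrow> x = 0"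
  by (metis norm_eq_zero norm_qcnj)

lemma bounded_linear_qcnj: "bounded_linear qcnj"
  by (rule bounded_linear_intro[where K = 1]) simp_all

lemma bounded_linear_qre: "bounded_linear qre"
proof -
  have "qre = (\<lambda>x. inner x 1)"
    by (auto simp: inner_quat_def)
  then show ?thesis
    using bounded_linear_inner_left[of "1::quat"] by simp
qed

lemma qre_mult_commute: "qre (x * y) = qre (y * x)"
  by (simp add: algebra_simps)

lemma inner_quat_eq: "inner x y = qre (x * qcnj y)" "inner x y = qre (qcnj x * y)"
  by (simp_all add: inner_quat_def algebra_simps)

lemma mult_qcnj_self: "x * qcnj x = of_real ((norm x)\<^sup>2)" "qcnj x * x = of_real ((norm x)\<^sup>2)"
  by (simp_all add: quat_times_qcnj of_real_def power2_norm_eq_inner)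

lemma norm_quat_sq: "(norm x)\<^sup>2 = (qre x)\<^sup>2 + (qi x)\<^sup>2 + (qj x)\<^sup>2 + (qk x)\<^sup>2"
  unfolding power2_norm_eq_inner by (simp add: inner_quat_def power2_eq_square)

lemma of_real_commute_quat: "of_real r * (x::quat) = x * of_real r"
  by (simp add: of_real_def)

lemma imag_unit_sphere_iff:
  "I \<in> imag_unit_sphere \<longleftrightarrow> qre I = 0 \<and> (qi I)\<^sup>2 + (qj I)\<^sup>2 + (qk I)\<^sup>2 = 1"
proof -
  have "norm I = 1 \<longleftrightarrow> (norm I)\<^sup>2 = 1"
    by (smt (verit) norm_ge_zero power2_eq_1_iff)
  then show ?thesis
    by (auto simp: imag_unit_sphere_def norm_quat_sq)
qed

lemma imag_unit_mult_self: "I \<in> imag_unit_sphere \<Longrightarrow> I * I = -1"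
  by (simp add: imag_unit_sphere_iff quat_eq_iff power2_eq_square algebra_simps)

text \<open>The identification of the complex numbers with \<open>\<complex>\<^sub>I\<close> that sends \<open>\<i>\<close> to \<open>I\<close>. It is a ring
  homomorphism when \<open>I\<close> is an imaginary unit, and all complex analysis below passes through it.\<close>

definition slice_of :: "quat \<Rightarrow> complex \<Rightarrow> quat" where
  "slice_of I z = of_real (Re z) + I * of_real (Im z)"

lemma slice_of_add: "slice_of I (z + w) = slice_of I z + slice_of I w"
  by (simp add: slice_of_def algebra_simps)

lemma slice_of_simps [simp]: "slice_of I 0 = 0" "slice_of I 1 = 1" "slice_of I \<i> = I"
   "slice_of I (of_real x) = of_real x"
  by (simp_all add: slice_of_def)

lemma slice_of_mult:
  assumes "I \<in> imag_unit_sphere"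
  shows "slice_of I (z * w) = slice_of I z * slice_of I w"
  using imag_unit_mult_self[OF assms]
  by (simp add: slice_of_def of_real_def algebra_simps flip: mult.assoc)

lemma slice_of_power:
  assumes "I \<in> imag_unit_sphere"
  shows "slice_of I (z ^ n) = slice_of I z ^ n"
  by (induction n) (simp_all add: slice_of_mult[OF assms])

lemma norm_slice_of:
  assumes "I \<in> imag_unit_sphere"
  shows "norm (slice_of I z) = norm z"
proof -
  have "qre I = 0"
    using assms by (simp add: imag_unit_sphere_iff)
  then have "(norm (slice_of I z))\<^sup>2
      = (Re z)\<^sup>2 + ((qi I)\<^sup>2 + (qj I)\<^sup>2 + (qk I)\<^sup>2) * (Im z)\<^sup>2"
    unfolding norm_quat_sq
    by (simp add: slice_of_def of_real_def power_mult_distrib algebra_simps)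
  then have "(norm (slice_of I z))\<^sup>2 = (norm z)\<^sup>2"
    using assms by (simp add: imag_unit_sphere_iff cmod_power2)
  then show ?thesis
    by simp
qed

lemma bounded_linear_slice_of: 
  assumes "I \<in> imag_unit_sphere"
  shows "bounded_linear (slice_of I)"
  by (rule bounded_linear_intro[where K = 1])
     (simp_all add: slice_of_add norm_slice_of[OF assms], simp add: slice_of_def algebra_simps of_real_def)

lemma ex_slice: "\<exists>I\<in>imag_unit_sphere. \<exists>z. p = slice_of I z"
proof (cases "p = of_real (qre p)")
  case True
  have "Quat 0 1 0 0 \<in> imag_unit_sphere"
    by (simp add: imag_unit_sphere_iff)
  then show ?thesis
    using True by (metis slice_of_simps(4))
next
  case False
  define v where "v = p - of_real (qre p)"
  have v: "v \<noteq> 0" "qre v = 0"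
    using False by (simp_all add: v_def)
  have "v /\<^sub>R norm v \<in> imag_unit_sphere"
    using v by (simp add: imag_unit_sphere_def)
  moreover have "p = slice_of (v /\<^sub>R norm v) (Complex (qre p) (norm v))"
    using v by (simp add: slice_of_def of_real_def) (simp add: v_def of_real_def)
  ultimately show ?thesis
    by blast
qed

section \<open>Slice regular functions and power series\<close>

lemma partial_derivatives:
  assumes D: "(f has_derivative D) (at (of_real x + I * of_real y :: quat))"
  shows "((\<lambda>t. f (of_real t + I * of_real y)) has_vector_derivative D 1) (at x)"
    and "((\<lambda>t. f (of_real x + I * of_real t)) has_vector_derivative D I) (at y)"
proof -
  interpret D: bounded_linear D
    using D by (rule has_derivative_bounded_linear)
  have "((\<lambda>t. of_real t + I * of_real y) has_derivative (\<lambda>h. of_real h)) (at x)"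
    by (auto intro!: derivative_eq_intros)
  from has_derivative_compose[OF this D]
  show "((\<lambda>t. f (of_real t + I * of_real y)) has_vector_derivative D 1) (at x)"
    by (simp add: has_vector_derivative_def of_real_def D.scaleR)
  have "((\<lambda>t. of_real x + I * of_real t) has_derivative (\<lambda>h. I * of_real h)) (at y)"
    by (auto intro!: derivative_eq_intros)
  from has_derivative_compose[OF this D]
  show "((\<lambda>t. f (of_real x + I * of_real t)) has_vector_derivative D I) (at y)"
    by (simp add: has_vector_derivative_def of_real_def D.scaleR)
qed

text \<open>The two partial derivatives along \<open>\<complex>\<^sub>I\<close> are the values at \<open>1\<close> and \<open>I\<close> of the Frechet derivative.
  This turns slice regularity into a linear condition on that derivative.\<close>

lemma slice_regular_on_iff:
  "slice_regular_on f \<Omega> \<longleftrightarrow> open \<Omega> \<and>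
     (\<forall>p\<in>\<Omega>. \<exists>D. (f has_derivative D) (at p) \<and>
        (\<forall>I\<in>imag_unit_sphere. p \<in> range (slice_of I) \<longrightarrow> D 1 + I * D I = 0))"
  (is "_ \<longleftrightarrow> _ \<and> ?R")
proof (cases "open \<Omega>")
  case True
  have diff: "f differentiable_on \<Omega> \<longleftrightarrow> (\<forall>p\<in>\<Omega>. \<exists>D. (f has_derivative D) (at p))"
    unfolding differentiable_on_def differentiable_def using at_within_open[OF _ True] by metis
  have CR: "vector_derivative (\<lambda>t. f (of_real t + I * of_real y)) (at x)
        + I * vector_derivative (\<lambda>t. f (of_real x + I * of_real t)) (at y) = D 1 + I * D I"
    if "(f has_derivative D) (at (of_real x + I * of_real y))" for D I x y
    using partial_derivatives[OF that] by (simp add: vector_derivative_at)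
  show ?thesis
  proof
    assume L: "slice_regular_on f \<Omega>"
    have ?R
    proof
      fix p assume p: "p \<in> \<Omega>"
      then obtain D where D: "(f has_derivative D) (at p)"
        using L diff by (auto simp: slice_regular_on_def)
      have "D 1 + I * D I = 0" if "I \<in> imag_unit_sphere" "p = slice_of I z" for I z
        using L CR[of D "Re z" I "Im z"] D p that by (auto simp: slice_regular_on_def slice_of_def)
      with D show "\<exists>D. (f has_derivative D) (at p) \<and>
        (\<forall>I\<in>imag_unit_sphere. p \<in> range (slice_of I) \<longrightarrow> D 1 + I * D I = 0)"
        by blast
    qed
    with True show "open \<Omega> \<and> ?R" ..
  next
    assume R: "open \<Omega> \<and> ?R"
    have "vector_derivative (\<lambda>t. f (of_real t + I * of_real y)) (at x)
        + I * vector_derivative (\<lambda>t. f (of_real x + I * of_real t)) (at y) = 0"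
      if I: "I \<in> imag_unit_sphere" and p: "of_real x + I * of_real y \<in> \<Omega>" for I x y
    proof -
      obtain D where D: "(f has_derivative D) (at (of_real x + I * of_real y))"
        "of_real x + I * of_real y \<in> range (slice_of I) \<longrightarrow> D 1 + I * D I = 0"
        using R p I by blast
      have "of_real x + I * of_real y = slice_of I (Complex x y)"
        by (simp add: slice_of_def)
      then show ?thesis
        using CR[OF D(1)] D(2) by auto
    qed
    then show "slice_regular_on f \<Omega>"
      using R diff by (auto simp: slice_regular_on_def)
  qed
qed (simp add: slice_regular_on_def)

lemma slice_regular_on_cong:
  assumes "slice_regular_on f \<Omega>" "\<And>p. p \<in> \<Omega> \<Longrightarrow> f p = g p"
  shows "slice_regular_on g \<Omega>"
  unfolding slice_regular_on_iff
proof (intro conjI ballI)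
  show "open \<Omega>"
    using assms(1) by (simp add: slice_regular_on_def)
  fix p assume p: "p \<in> \<Omega>"
  then obtain D where D: "(f has_derivative D) (at p)"
      "\<forall>I\<in>imag_unit_sphere. p \<in> range (slice_of I) \<longrightarrow> D 1 + I * D I = 0"
    using assms(1) unfolding slice_regular_on_iff by blast
  have "(g has_derivative D) (at p)"
    using D(1) \<open>open \<Omega>\<close> p assms(2) by (rule has_derivative_transform_within_open)
  with D(2) show "\<exists>D. (g has_derivative D) (at p) \<and>
        (\<forall>I\<in>imag_unit_sphere. p \<in> range (slice_of I) \<longrightarrow> D 1 + I * D I = 0)"
    by blast
qed

text \<open>The derivative of \<open>p\<^sup>n\<close> in the direction \<open>h\<close>. Since \<open>h\<close> need not commute with \<open>p\<close>, it is the sum of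
  the products \<open>p\<^sup>i h p\<^sup>n\<^sup>-\<^sup>1\<^sup>-\<^sup>i\<close>, here in recursive form.\<close>

primrec power_derivative :: "quat \<Rightarrow> nat \<Rightarrow> quat \<Rightarrow> quat" where
  "power_derivative p 0 h = 0"
| "power_derivative p (Suc n) h = h * p ^ n + p * power_derivative p n h"

lemma has_derivative_quat_power: "((\<lambda>p. p ^ n) has_derivative power_derivative p n) (at p within S)"
proof (induction n)
  case 0
  have "power_derivative p 0 = (\<lambda>h. 0)"
    by auto
  then show ?case
    by simp
next
  case (Suc n)
  have "((\<lambda>p. p * p ^ n) has_derivative (\<lambda>h. p * power_derivative p n h + h * p ^ n)) (at p within S)"
    by (rule has_derivative_mult[OF has_derivative_ident Suc])
  moreover have "power_derivative p (Suc n) = (\<lambda>h. p * power_derivative p n h + h * p ^ n)"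
    by auto
  ultimately show ?case
    by simp
qed

lemma norm_power_derivative_le: "norm (power_derivative p n h) \<le> real n * norm p ^ (n - 1) * norm h"
proof (induction n)
  case (Suc n)
  have "norm (power_derivative p (Suc n) h)
      \<le> norm h * norm p ^ n + norm p * (real n * norm p ^ (n - 1) * norm h)"
    unfolding power_derivative.simps
    using Suc by (intro norm_triangle_mono) (auto simp: norm_mult norm_power intro!: mult_left_mono)
  also have "\<dots> = real (Suc n) * norm p ^ (Suc n - 1) * norm h"
    by (cases n) (simp_all add: algebra_simps)
  finally show ?case .
qed simp

text \<open>Along \<open>\<complex>\<^sub>I\<close> the direction \<open>I\<close> commutes with the base point. The factor \<open>I\<close> can then be moved to the
  left, which is what the Cauchy-Riemann equation for power series needs.\<close>

lemma power_derivative_commuting: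
  assumes "h * p = p * h"
  shows "power_derivative p n h = h * power_derivative p n 1"
proof (induction n)
  case (Suc n)
  have "p * (h * power_derivative p n 1) = h * (p * power_derivative p n 1)"
    using assms by (metis mult.assoc)
  then show ?case
    using Suc by (simp add: algebra_simps)
qed simp

lemma summable_power_series:
  assumes "\<And>k. norm (a k) \<le> C" "norm (p::quat) < 1"
  shows "summable (\<lambda>k. norm (p ^ k * a k))" "summable (\<lambda>k. p ^ k * a k)"
proof -
  show "summable (\<lambda>k. norm (p ^ k * a k))"
  proof (rule summable_comparison_test')
    show "summable (\<lambda>k. norm p ^ k * C)"
      using assms(2) by (simp add: summable_mult2 summable_geometric)
    show "norm (norm (p ^ k * a k)) \<le> norm p ^ k * C" if "k \<ge> 0" for k
      using assms(1) by (simp add: norm_mult norm_power mult_left_mono)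
  qed
  then show "summable (\<lambda>k. p ^ k * a k)"
    by (rule summable_norm_cancel)
qed

text \<open>Differentiation term by term is justified on each ball of radius \<open>r < 1\<close>, where the derivative of
  the \<open>n\<close>th term is at most \<open>n r\<^sup>n\<^sup>-\<^sup>1 C\<close>. The Cauchy-Riemann equation then holds term by term.\<close>

lemma slice_regular_power_series:
  assumes bd: "\<And>k. norm (a k) \<le> C"
  shows "slice_regular_on (\<lambda>p. \<Sum>k. p ^ k * a k) (ball 0 1)"
  unfolding slice_regular_on_iff
proof (intro conjI ballI)
  fix p :: quat assume "p \<in> ball 0 1"
  then obtain r where r: "norm p < r" "r < 1"
    using dense[of "norm p" 1] by auto
  then have r0: "0 < r"
    by (smt (verit) norm_ge_zero)
  have C0: "C \<ge> 0"
    using bd[of 0] norm_ge_zero[of "a 0"] by linarith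
  define M where "M n = real n * r ^ (n - 1) * C" for n
  define D where "D q h = (\<Sum>n. power_derivative q n h * a n)" for q h
  have sumM: "summable M"
  proof -
    have "summable (\<lambda>n. real (Suc n) * r ^ n)"
      using geometric_deriv_sums[of r] r r0 by (simp add: sums_iff)
    then have "summable (\<lambda>n. M (Suc n))"
      by (simp add: M_def summable_mult2)
    then show ?thesis
      by (subst (asm) summable_Suc_iff)
  qed
  have le: "norm (power_derivative q n h * a n) \<le> M n * norm h" if "q \<in> ball 0 r" for q h n
  proof -
    have "norm (power_derivative q n h * a n) \<le> (real n * norm q ^ (n - 1) * norm h) * C"
      unfolding norm_mult using norm_power_derivative_le bd by (intro mult_mono) auto
    also have "\<dots> \<le> (real n * r ^ (n - 1) * norm h) * C"
      using that C0 by (intro mult_right_mono mult_left_mono power_mono) auto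
    finally show ?thesis
      by (simp add: M_def algebra_simps)
  qed
  have sumD: "summable (\<lambda>n. norm (power_derivative q n h * a n))" if "q \<in> ball 0 r" for q h
    by (rule summable_comparison_test'[OF summable_mult2[OF sumM, of "norm h"], of 0]) (use le[OF that] in auto)
  have "\<exists>g. \<forall>q\<in>ball 0 r. (\<lambda>n. q ^ n * a n) sums (g q) \<and> (g has_derivative D q) (at q within ball 0 r)"
  proof (rule has_derivative_series)
    show "convex (ball 0 r :: quat set)"
      by simp
    show "((\<lambda>q. q ^ n * a n) has_derivative (\<lambda>h. power_derivative q n h * a n)) (at q within ball 0 r)" for n q
      by (rule has_derivative_mult_left[OF has_derivative_quat_power])
    show "(0::quat) \<in> ball 0 r"
      using r0 by simp
    show "(\<lambda>n. 0 ^ n * a n) sums (\<Sum>n. 0 ^ n * a n)"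
      by (intro summable_sums summable_power_series(2)[of a C] bd) auto
    fix e :: real assume e: "e > 0"
    have "(\<lambda>n. \<Sum>i. M (i + n)) \<longlonglongrightarrow> 0"
      using sumM by (rule suminf_exist_split2)
    then have "\<forall>\<^sub>F n in sequentially. (\<Sum>i. M (i + n)) < e"
      using e by (rule order_tendstoD)
    then show "\<forall>\<^sub>F n in sequentially. \<forall>q\<in>ball 0 r. \<forall>h.
        norm ((\<Sum>i<n. power_derivative q i h * a i) - D q h) \<le> e * norm h"
    proof (eventually_elim, intro ballI allI)
      fix n and q h :: quat assume n: "(\<Sum>i. M (i + n)) < e" and q: "q \<in> ball 0 r"
      note s = sumD[OF q, of h]
      have "norm ((\<Sum>i<n. power_derivative q i h * a i) - D q h)
          = norm (\<Sum>i. power_derivative q (i + n) h * a (i + n))"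
        unfolding D_def using suminf_minus_initial_segment[OF summable_norm_cancel[OF s], of n]
        by (simp add: norm_minus_commute)
      also have "\<dots> \<le> (\<Sum>i. M (i + n) * norm h)"
        using le[OF q] sumM
        by (intro norm_suminf_le summable_mult2) (auto simp: summable_iff_shift)
      also have "\<dots> = (\<Sum>i. M (i + n)) * norm h"
        using sumM by (intro suminf_mult2[symmetric]) (auto simp: summable_iff_shift)
      also have "\<dots> \<le> e * norm h"
        using n by (intro mult_right_mono) auto
      finally show "norm ((\<Sum>i<n. power_derivative q i h * a i) - D q h) \<le> e * norm h" .
    qed
  qed
  then obtain g where g: "\<And>q. q \<in> ball 0 r \<Longrightarrow> (\<lambda>n. q ^ n * a n) sums (g q)"
     "\<And>q. q \<in> ball 0 r \<Longrightarrow> (g has_derivative D q) (at q within ball 0 r)"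
    by blast
  have p: "p \<in> ball 0 r"
    using r by simp
  then have "(g has_derivative D p) (at p)"
    using g(2)[OF p] at_within_open[OF p open_ball] by metis
  then have *: "((\<lambda>p. \<Sum>k. p ^ k * a k) has_derivative D p) (at p)"
    by (rule has_derivative_transform_within_open[OF _ _ p]) (use g(1) in \<open>auto simp: sums_iff\<close>)
  have "D p 1 + I * D p I = 0" if I: "I \<in> imag_unit_sphere" and z: "p = slice_of I z" for I z
  proof -
    have "I * p = p * I"
      unfolding z slice_of_def by (simp add: algebra_simps of_real_def)
    then have "power_derivative p n I * a n = I * (power_derivative p n 1 * a n)" for n
      using power_derivative_commuting[of I p n] by (simp only: mult.assoc)
    then have "D p I = (\<Sum>n. I * (power_derivative p n 1 * a n))"
      by (simp add: D_def)
    also have "\<dots> = I * D p 1"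
      unfolding D_def by (rule suminf_mult[OF summable_norm_cancel[OF sumD[OF p]]])
    finally show ?thesis
      using imag_unit_mult_self[OF I] by (simp flip: mult.assoc)
  qed
  with * show "\<exists>D. ((\<lambda>p. \<Sum>k. p ^ k * a k) has_derivative D) (at p) \<and>
        (\<forall>I\<in>imag_unit_sphere. p \<in> range (slice_of I) \<longrightarrow> D 1 + I * D I = 0)"
    by blast
qed simp

text \<open>If \<open>J\<close> is an imaginary unit orthogonal to \<open>I\<close>, then every quaternion is uniquely \<open>u + v J\<close> with
  \<open>u, v \<in> \<complex>\<^sub>I\<close>. The function below returns \<open>u\<close> as a complex number.\<close>

definition slice_coord :: "quat \<Rightarrow> quat \<Rightarrow> complex" where
  "slice_coord I q = Complex (qre q) (- qre (I * q))"

lemma slice_coord_mult: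
  assumes "I \<in> imag_unit_sphere"
  shows "slice_coord I (slice_of I z * q) = z * slice_coord I q"
proof -
  have "I * (I * q) = - q"
    using imag_unit_mult_self[OF assms] by (simp flip: mult.assoc)
  moreover have "slice_of I z * q = Re z *\<^sub>R q + Im z *\<^sub>R (I * q)"
    by (simp add: slice_of_def of_real_def distrib_right)
  ultimately show ?thesis
    by (simp add: slice_coord_def complex_eq_iff distrib_left del: times_quat.sel)
qed

lemma bounded_linear_slice_coord: "bounded_linear (slice_coord I)"
proof -
  have "bounded_linear (\<lambda>q. of_real (qre q) - \<i> * of_real (qre (I * q)))"
    by (intro bounded_linear_sub bounded_linear_compose[OF bounded_linear_of_real]
        bounded_linear_const_mult bounded_linear_qre bounded_linear_compose[OF bounded_linear_qre]
        bounded_linear_mult_right)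
  moreover have "slice_coord I = (\<lambda>q. of_real (qre q) - \<i> * of_real (qre (I * q)))"
    by (auto simp: slice_coord_def complex_eq_iff)
  ultimately show ?thesis
    by simp
qed

text \<open>The \<open>\<complex>\<^sub>I\<close>-component of \<open>q\<close> is \<open>(q - I q I) / 2\<close>. Taking it for all products \<open>q b\<close>, with \<open>b\<close> in the
  standard basis, recovers \<open>q\<close>, since \<open>\<Sum>\<^sub>b b I cnj(b) = 0\<close>. This plays the part of the usual splitting
  along \<open>\<complex>\<^sub>I \<oplus> \<complex>\<^sub>I J\<close> and avoids the choice of \<open>J\<close>.\<close>

lemma slice_decomposition:
  assumes "I \<in> imag_unit_sphere"
  shows "q = (\<Sum>b\<in>Basis. slice_of I (slice_coord I (q * b)) * qcnj b) /\<^sub>R 2"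
proof -
  have "qre I = 0" "qi I * qi I + qj I * qj I + qk I * qk I = 1"
    using assms by (simp_all add: imag_unit_sphere_iff power2_eq_square)
  then show ?thesis
    by (simp add: Basis_quat_def quat_eq_iff slice_of_def slice_coord_def of_real_def) algebra
qed

text \<open>The slice condition makes the derivative along \<open>\<complex>\<^sub>I\<close> commute with left multiplication by \<open>I\<close>, so that
  the coordinates of \<open>f b\<close> are holomorphic on the unit disc. Their Taylor expansions combine
  to an expansion of \<open>f\<close> on \<open>\<complex>\<^sub>I\<close>.\<close>

lemma slice_regular_imp_slice_power_series:
  assumes f: "slice_regular_on f (ball 0 1)" and I: "I \<in> imag_unit_sphere"
  shows "\<exists>a. \<forall>z. norm z < 1 \<longrightarrow> (\<lambda>k. slice_of I z ^ k * a k) sums f (slice_of I z)"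
proof -
  define F where "F b z = slice_coord I (f (slice_of I z) * b)" for b z
  define c where "c b k = (deriv ^^ k) (F b) 0 / fact k" for b k
  have hol: "F b holomorphic_on ball 0 1" for b
  proof (rule holomorphic_onI)
    fix z :: complex assume z: "z \<in> ball 0 1"
    then have "slice_of I z \<in> ball 0 1"
      using norm_slice_of[OF I] by simp
    then obtain D where D: "(f has_derivative D) (at (slice_of I z))" and CR: "D 1 + I * D I = 0"
      using f I unfolding slice_regular_on_iff by blast
    interpret D: bounded_linear D
      using D by (rule has_derivative_bounded_linear)
    \<comment> \<open>Multiplying the Cauchy-Riemann equation by \<open>I\<close> shows that the restriction of \<open>D\<close> to \<open>\<complex>\<^sub>I\<close> is left linear over \<open>\<complex>\<^sub>I\<close>.\<close>
    have "I * (D 1 + I * D I) = 0"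
      using CR by simp
    then have DI: "D I = I * D 1"
      using imag_unit_mult_self[OF I] by (simp add: algebra_simps flip: mult.assoc)
    have Dh: "D (slice_of I h) = slice_of I h * D 1" for h
    proof -
      have "D (slice_of I h) = Re h *\<^sub>R D 1 + Im h *\<^sub>R D I"
        by (simp add: slice_of_def of_real_def D.add D.scaleR)
      then show ?thesis
        by (simp add: DI slice_of_def of_real_def algebra_simps)
    qed
    have "((\<lambda>z. f (slice_of I z)) has_derivative (\<lambda>h. D (slice_of I h))) (at z)"
      by (rule has_derivative_compose[OF bounded_linear_imp_has_derivative[OF bounded_linear_slice_of[OF I]] D])
    then have "(F b has_derivative (\<lambda>h. slice_coord I (D (slice_of I h) * b))) (at z)"
      unfolding F_def
      by (rule bounded_linear.has_derivative[OF bounded_linear_slice_coord has_derivative_mult_left])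
    moreover have "(\<lambda>h. slice_coord I (D (slice_of I h) * b)) = (*) (slice_coord I (D 1 * b))"
      by (simp add: Dh mult.assoc slice_coord_mult[OF I] mult.commute fun_eq_iff)
    ultimately have "(F b has_field_derivative slice_coord I (D 1 * b)) (at z)"
      by (simp add: has_field_derivative_def)
    then show "F b field_differentiable at z within ball 0 1"
      by (meson field_differentiable_at_within field_differentiable_def)
  qed
  have "(\<lambda>k. slice_of I z ^ k * ((\<Sum>b\<in>Basis. slice_of I (c b k) * qcnj b) /\<^sub>R 2)) sums f (slice_of I z)"
    if "norm z < 1" for z
  proof -
    have "(\<lambda>k. c b k * z ^ k) sums F b z" for b
      using holomorphic_power_series[OF hol, of z b] that by (simp add: c_def)
    then have "(\<lambda>k. slice_of I (c b k * z ^ k) * qcnj b) sums (slice_of I (F b z) * qcnj b)" for b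
      by (intro sums_mult2 bounded_linear.sums[OF bounded_linear_slice_of[OF I]])
    then have "(\<lambda>k. (\<Sum>b\<in>Basis. slice_of I (c b k * z ^ k) * qcnj b) /\<^sub>R 2)
        sums ((\<Sum>b\<in>Basis. slice_of I (F b z) * qcnj b) /\<^sub>R 2)"
      by (intro sums_scaleR_right sums_sum)
    moreover have "(\<Sum>b\<in>Basis. slice_of I (F b z) * qcnj b) /\<^sub>R 2 = f (slice_of I z)"
      unfolding F_def by (rule slice_decomposition[OF I, symmetric])
    moreover have "slice_of I (c b k * z ^ k) = slice_of I z ^ k * slice_of I (c b k)" for b k
      by (metis mult.commute slice_of_mult[OF I] slice_of_power[OF I])
    ultimately show ?thesis
      by (simp only: sum_distrib_left mult.assoc mult_scaleR_right)
  qed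
  then show ?thesis
    by (intro exI allI impI)
qed

lemma real_power_series_unique:
  fixes a b :: "nat \<Rightarrow> quat"
  assumes "\<And>x::real. \<bar>x\<bar> < 1 \<Longrightarrow> (\<lambda>k. x ^ k *\<^sub>R a k) sums f x"
    and "\<And>x::real. \<bar>x\<bar> < 1 \<Longrightarrow> (\<lambda>k. x ^ k *\<^sub>R b k) sums f x"
  shows "a = b"
proof
  fix k
  have "inner (a k - b k) e = 0" for e
  proof -
    have s: "(\<lambda>k. inner (a k - b k) e * x ^ k) sums 0" if "\<bar>x\<bar> < 1" for x :: real
    proof -
      have "(\<lambda>k. inner (x ^ k *\<^sub>R a k - x ^ k *\<^sub>R b k) e) sums inner (f x - f x) e"
        using assms that by (intro bounded_linear.sums[OF bounded_linear_inner_left] sums_diff)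
      then show ?thesis
        by (simp add: mult.commute flip: scaleR_diff_right)
    qed
    have z: "inner (a 0 - b 0) e = 0"
      using s[of 0] by simp
    show ?thesis
    proof (rule ccontr)
      assume ne: "inner (a k - b k) e \<noteq> 0"
      then have "k > 0"
        using z by (cases k) auto
      obtain r where "0 < r" and "\<And>x::real. x \<in> cball 0 r - {0} \<Longrightarrow> (0::real) \<noteq> 0"
      proof (rule powser_0_nonzero[of 1 0 "\<lambda>k. inner (a k - b k) e" "\<lambda>_. 0::real" k])
        show "(\<lambda>k. inner (a k - b k) e * (x - 0) ^ k) sums 0" if "norm (x - 0) < 1" for x :: real
          using s[of x] that by simp
      qed (use ne \<open>k > 0\<close> in auto)
      then have "cball 0 r - {0::real} = {}"
        by blast
      moreover have "r \<in> cball 0 r - {0::real}"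
        using \<open>0 < r\<close> by simp
      ultimately show False
        by blast
    qed
  qed
  from this[of "a k - b k"] show "a k = b k"
    by simp
qed

text \<open>All slices contain the real axis, and there the expansion has only one possible sequence of
  coefficients. Hence one sequence serves all slices.\<close>

proposition slice_regular_imp_power_series:
  assumes f: "slice_regular_on f (ball 0 1)"
  obtains a where "\<And>p. norm p < 1 \<Longrightarrow> (\<lambda>k. p ^ k * a k) sums f p"
proof -
  obtain a where a: "\<And>I z. \<lbrakk>I \<in> imag_unit_sphere; norm z < 1\<rbrakk> \<Longrightarrow>
      (\<lambda>k. slice_of I z ^ k * a I k) sums f (slice_of I z)"
    using slice_regular_imp_slice_power_series[OF f] by metis
  have "(\<lambda>k. x ^ k *\<^sub>R a I k) sums f (of_real x)" if "\<bar>x\<bar> < 1" "I \<in> imag_unit_sphere" for I x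
    using a[of I "of_real x"] that by (simp add: scaleR_conv_of_real)
  then have eq: "a I = a J" if "I \<in> imag_unit_sphere" "J \<in> imag_unit_sphere" for I J
    using that real_power_series_unique by meson
  obtain J where J: "J \<in> imag_unit_sphere"
    using ex_slice by blast
  show thesis
  proof
    fix p :: quat assume p: "norm p < 1"
    obtain I z where I: "I \<in> imag_unit_sphere" "p = slice_of I z"
      using ex_slice by blast
    then show "(\<lambda>k. p ^ k * a J k) sums f p"
      using a[of I z] p eq[OF I(1) J] norm_slice_of[of I z] by simp
  qed
qed

section \<open>Functions bounded by one act as contractions\<close>

lemma inner_mult_qcnj: "inner x (qcnj a * y) = inner (a * x) (y::quat)"
  unfolding inner_quat_eq(2) by (simp add: mult.assoc del: times_quat.sel)

text \<open>Pairs \<open>(u, v)\<close> stand for elements \<open>u + \<i> v\<close> of the complexified quaternions, and the left hand side is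
  the squared norm of \<open>(\<alpha> + \<i> \<beta>)(u + \<i> v)\<close>. The maximum of \<open>\<bar>\<alpha> + I \<beta>\<bar>\<^sup>2\<close> over all imaginary units is
  \<open>\<bar>\<alpha>\<bar>\<^sup>2 + \<bar>\<beta>\<bar>\<^sup>2 + 2 \<bar>Im (\<alpha> cnj(\<beta>))\<bar>\<close>, and the same number bounds the squared norm of multiplication by
  \<open>\<alpha> + \<i> \<beta>\<close>. So a bound on a whole sphere is a bound for multiplication at one complex point.\<close>

lemma contractive_on_sphere:
  assumes bd: "\<And>I. I \<in> imag_unit_sphere \<Longrightarrow> norm (\<alpha> + I * \<beta>) \<le> C"
  shows "(norm (\<alpha> * u - \<beta> * v))\<^sup>2 + (norm (\<alpha> * v + \<beta> * u))\<^sup>2 \<le> C\<^sup>2 * ((norm u)\<^sup>2 + (norm v)\<^sup>2)"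
proof -
  define vim where "vim x = x - of_real (qre x)" for x
  have vim: "(norm (vim x))\<^sup>2 = (norm x)\<^sup>2 - (qre x)\<^sup>2" "qre (vim x) = 0" for x
    by (simp_all add: vim_def norm_quat_sq)
  define \<delta> \<gamma> w where "\<delta> = \<alpha> * qcnj \<beta>" and "\<gamma> = qcnj \<beta> * \<alpha>" and "w = v * qcnj u - u * qcnj v"
  \<comment> \<open>The two products have the same real part and the same norm, hence imaginary parts of equal length.\<close>
  have "(norm (vim \<gamma>))\<^sup>2 = (norm (vim \<delta>))\<^sup>2"
    unfolding vim \<gamma>_def \<delta>_def qre_mult_commute[of "qcnj \<beta>" \<alpha>] by (simp add: norm_mult mult.commute)
  then have eq: "norm (vim \<gamma>) = norm (vim \<delta>)"
    by simp
  \<comment> \<open>The maximum over the sphere is attained in the direction of the imaginary part of \<open>\<delta>\<close>.\<close>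
  have "\<exists>I\<in>imag_unit_sphere. inner I \<delta> = norm (vim \<delta>)"
  proof (cases "vim \<delta> = 0")
    case True
    obtain I where I: "I \<in> imag_unit_sphere"
      using ex_slice by blast
    then have "inner I \<delta> = 0"
      using True by (simp add: vim_def quat_eq_iff inner_quat_def imag_unit_sphere_def)
    with I True show ?thesis
      by (intro bexI[of _ I]) auto
  next
    case False
    define I where "I = vim \<delta> /\<^sub>R norm (vim \<delta>)"
    have I: "I \<in> imag_unit_sphere"
      using False by (simp add: I_def imag_unit_sphere_def vim)
    have "inner (vim \<delta>) \<delta> = inner (vim \<delta>) (vim \<delta>)"
      by (simp add: vim_def inner_quat_def)
    also have "\<dots> = norm (vim \<delta>) * norm (vim \<delta>)"
      by (simp add: power2_norm_eq_inner[symmetric] power2_eq_square)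
    finally have "inner I \<delta> = norm (vim \<delta>)"
      using False by (simp add: I_def)
    with I show ?thesis ..
  qed
  then obtain I where I: "I \<in> imag_unit_sphere" "inner I \<delta> = norm (vim \<delta>)" ..
  have "inner \<alpha> (I * \<beta>) = inner I \<delta>"
    unfolding \<delta>_def by (subst inner_commute) (simp add: inner_quat_eq(1) mult.assoc del: times_quat.sel)
  then have "(norm \<alpha>)\<^sup>2 + (norm \<beta>)\<^sup>2 + 2 * norm (vim \<delta>) = (norm (\<alpha> + I * \<beta>))\<^sup>2"
    using I unfolding power2_norm_eq_inner[of "\<alpha> + I * \<beta>"] inner_add
    by (simp add: power2_norm_eq_inner[symmetric] norm_mult imag_unit_sphere_def inner_commute[of "I * \<beta>"])
  also have "\<dots> \<le> C\<^sup>2"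
    using bd[OF I(1)] by (intro power_mono) auto
  finally have C: "(norm \<alpha>)\<^sup>2 + (norm \<beta>)\<^sup>2 + 2 * norm (vim \<delta>) \<le> C\<^sup>2" .
  have w0: "qre w = 0"
    by (simp add: w_def algebra_simps)
  have "norm w \<le> norm (v * qcnj u) + norm (u * qcnj v)"
    unfolding w_def by (rule norm_triangle_ineq4)
  also have "\<dots> = 2 * (norm u * norm v)"
    by (simp add: norm_mult)
  also have "\<dots> \<le> (norm u)\<^sup>2 + (norm v)\<^sup>2"
    using sum_squares_bound[of "norm u" "norm v"] by simp
  finally have w: "norm w \<le> (norm u)\<^sup>2 + (norm v)\<^sup>2" .
  have "qre (\<gamma> * w) = inner (vim \<gamma>) (- w)"
    using w0 by (simp add: inner_quat_def vim_def)
  also have "\<dots> \<le> norm (vim \<gamma>) * norm (- w)"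
    by (rule norm_cauchy_schwarz)
  also have "\<dots> \<le> norm (vim \<delta>) * ((norm u)\<^sup>2 + (norm v)\<^sup>2)"
    using w eq by (simp add: mult_left_mono)
  finally have cross: "qre (\<gamma> * w) \<le> norm (vim \<delta>) * ((norm u)\<^sup>2 + (norm v)\<^sup>2)" .
  have *: "inner (\<alpha> * x) (\<beta> * y) = qre (\<gamma> * (x * qcnj y))" for x y
    unfolding inner_quat_eq(1) \<gamma>_def using qre_mult_commute[of "\<alpha> * x * qcnj y" "qcnj \<beta>"]
    by (simp add: mult.assoc del: times_quat.sel)
  have "(norm (\<alpha> * u - \<beta> * v))\<^sup>2 + (norm (\<alpha> * v + \<beta> * u))\<^sup>2
      = ((norm \<alpha>)\<^sup>2 + (norm \<beta>)\<^sup>2) * ((norm u)\<^sup>2 + (norm v)\<^sup>2)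
        + 2 * (inner (\<alpha> * v) (\<beta> * u) - inner (\<alpha> * u) (\<beta> * v))"
    unfolding power2_norm_eq_inner[of "_ - _"] power2_norm_eq_inner[of "_ + _"] inner_diff inner_add
    by (simp add: power2_norm_eq_inner[symmetric] norm_mult power_mult_distrib algebra_simps
        inner_commute[of "\<beta> * v"] inner_commute[of "\<beta> * u"] del: times_quat.sel)
  also have "inner (\<alpha> * v) (\<beta> * u) - inner (\<alpha> * u) (\<beta> * v) = qre (\<gamma> * w)"
    unfolding * w_def by (simp add: right_diff_distrib del: times_quat.sel)
  also have "((norm \<alpha>)\<^sup>2 + (norm \<beta>)\<^sup>2) * ((norm u)\<^sup>2 + (norm v)\<^sup>2) + 2 * qre (\<gamma> * w)
     \<le> ((norm \<alpha>)\<^sup>2 + (norm \<beta>)\<^sup>2 + 2 * norm (vim \<delta>)) * ((norm u)\<^sup>2 + (norm v)\<^sup>2)"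
    using cross by (simp add: algebra_simps del: times_quat.sel)
  also have "\<dots> \<le> C\<^sup>2 * ((norm u)\<^sup>2 + (norm v)\<^sup>2)"
    using C by (intro mult_right_mono) auto
  finally show ?thesis .
qed

lemma sum_cos_roots_of_unity:
  assumes "k < M" "l < M"
  shows "(\<Sum>j<M. cos (2 * pi * real j / real M * real k - 2 * pi * real j / real M * real l))
       = (if k = l then real M else 0)"
proof (cases "k = l")
  case False
  define \<phi> where "\<phi> = 2 * pi * (real k - real l) / real M"
  define x where "x = cis \<phi>"
  have "x \<noteq> 1"
  proof
    assume "x = 1"
    then have "cos \<phi> = 1"
      by (simp add: x_def complex_eq_iff)
    then obtain n :: int where n: "\<phi> = of_int n * 2 * pi"
      by (auto simp: cos_one_2pi_int)
    then have "(2 * pi) * (real k - real l) = (2 * pi) * (of_int n * real M)"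
      using assms by (simp add: \<phi>_def field_simps)
    then have "real k - real l = of_int n * real M"
      by (subst (asm) mult_left_cancel) simp_all
    then have n': "int k - int l = n * int M"
      by (metis of_int_diff of_int_eq_iff of_int_mult of_int_of_nat_eq)
    have "\<bar>n * int M\<bar> < int M"
      using assms unfolding n'[symmetric] by linarith
    moreover have "int M \<le> \<bar>n * int M\<bar>" if "n \<noteq> 0"
      using that mult_right_mono[of 1 "\<bar>n\<bar>" "int M"] by (simp add: abs_mult)
    ultimately have "n = 0"
      by linarith
    then show False
      using n' False by simp
  qed
  have "x ^ M = cis (real M * \<phi>)"
    by (simp add: x_def Complex.DeMoivre)
  also have "real M * \<phi> = 2 * pi * of_int (int k - int l)"
    using assms by (simp add: \<phi>_def)
  finally have "x ^ M = 1"
    by (simp add: cis_multiple_2pi)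
  have "(\<Sum>j<M. cos (2 * pi * real j / real M * real k - 2 * pi * real j / real M * real l))
      = (\<Sum>j<M. Re (x ^ j))"
    by (intro sum.cong refl) (simp add: x_def Complex.DeMoivre \<phi>_def diff_divide_distrib algebra_simps)
  also have "\<dots> = Re (\<Sum>j<M. x ^ j)"
    by simp
  also have "(\<Sum>j<M. x ^ j) = 0"
    using \<open>x \<noteq> 1\<close> \<open>x ^ M = 1\<close> by (simp add: geometric_sum)
  finally show ?thesis
    using False by simp
qed simp

text \<open>Parseval's identity at the roots of unity of order \<open>M\<close>. Cosine and sine sums are the real and
  imaginary parts of the Fourier sum, kept apart because the values \<open>h k\<close> lie in a real space.\<close>

lemma discrete_Parseval:
  fixes h :: "nat \<Rightarrow> 'a::real_inner"
  defines "\<theta> M j \<equiv> 2 * pi * real j / real M"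
  shows "(\<Sum>j<M. (norm (\<Sum>k<M. cos (\<theta> M j * real k) *\<^sub>R h k))\<^sup>2 + (norm (\<Sum>k<M. sin (\<theta> M j * real k) *\<^sub>R h k))\<^sup>2)
       = real M * (\<Sum>k<M. (norm (h k))\<^sup>2)"
proof -
  have "(norm (\<Sum>k<M. cos (t * real k) *\<^sub>R h k))\<^sup>2 + (norm (\<Sum>k<M. sin (t * real k) *\<^sub>R h k))\<^sup>2
      = (\<Sum>k<M. \<Sum>l<M. cos (t * real k - t * real l) * inner (h k) (h l))" for t
    unfolding power2_norm_eq_inner inner_sum_left inner_sum_right sum.distrib[symmetric]
    by (subst sum.swap) (simp add: cos_diff algebra_simps)
  then have "(\<Sum>j<M. (norm (\<Sum>k<M. cos (\<theta> M j * real k) *\<^sub>R h k))\<^sup>2 + (norm (\<Sum>k<M. sin (\<theta> M j * real k) *\<^sub>R h k))\<^sup>2)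
      = (\<Sum>j<M. \<Sum>k<M. \<Sum>l<M. cos (\<theta> M j * real k - \<theta> M j * real l) * inner (h k) (h l))"
    by simp
  also have "\<dots> = (\<Sum>k<M. \<Sum>l<M. \<Sum>j<M. cos (\<theta> M j * real k - \<theta> M j * real l) * inner (h k) (h l))"
    by (subst sum.swap, rule sum.cong[OF refl], rule sum.swap)
  also have "\<dots> = (\<Sum>k<M. \<Sum>l<M. (if k = l then real M else 0) * inner (h k) (h l))"
    unfolding sum_distrib_right[symmetric] \<theta>_def
    by (intro sum.cong refl arg_cong2[of _ _ _ _ "(*)"] sum_cos_roots_of_unity) simp_all
  also have "\<dots> = (\<Sum>k<M. real M * inner (h k) (h k))"
    by (intro sum.cong refl) (simp add: if_distrib[of "\<lambda>x. x * _"] sum.delta cong: if_cong)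
  finally show ?thesis
    by (simp add: sum_distrib_left power2_norm_eq_inner)
qed

text \<open>The coefficients of the star product of two power series.\<close>

definition star_product :: "(nat \<Rightarrow> quat) \<Rightarrow> (nat \<Rightarrow> quat) \<Rightarrow> nat \<Rightarrow> quat" where
  "star_product a g k = (\<Sum>m\<le>k. a m * g (k - m))"

lemma sum_convolution_reindex:
  fixes F :: "nat \<Rightarrow> nat \<Rightarrow> 'a::comm_monoid_add"
  assumes "N + K \<le> M" "\<And>m l. m \<ge> N \<Longrightarrow> F m l = 0" "\<And>m l. l \<ge> K \<Longrightarrow> F m l = 0"
  shows "(\<Sum>k<M. \<Sum>m\<le>k. F m (k - m)) = (\<Sum>m<M. \<Sum>l<M. F m l)"
proof -
  have "(\<Sum>k<M. \<Sum>m\<le>k. F m (k - m)) = (\<Sum>(m, l)\<in>{(m, l). m + l < M}. F m l)"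
    by (rule sum.triangle_reindex[symmetric])
  also have "\<dots> = (\<Sum>(m, l)\<in>{..<M} \<times> {..<M}. F m l)"
  proof (rule sum.mono_neutral_left)
    show "\<forall>i\<in>{..<M} \<times> {..<M} - {(m, l). m + l < M}. (case i of (m, l) \<Rightarrow> F m l) = 0"
      using assms by (auto simp: not_less) (metis add_le_mono le_trans linorder_not_less nat_le_linear add_mono_thms_linordered_field(5))
  qed auto
  finally show ?thesis
    by (simp add: sum.cartesian_product)
qed

text \<open>At a complex number of modulus one, the value of a star product is the product of the values in the
  complexified quaternions, and there \<open>contractive_on_sphere\<close> applies. Summation over the roots of
  unity of order \<open>N + K\<close>, which exceeds the degree of the product, gives the bound on coefficients.\<close>

lemma polynomial_star_product_bound:
  fixes a g :: "nat \<Rightarrow> quat"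
  assumes bd: "\<And>p. norm p = 1 \<Longrightarrow> norm (\<Sum>k<N. p ^ k * a k) \<le> C"
    and a: "\<And>k. k \<ge> N \<Longrightarrow> a k = 0" and g: "\<And>k. k \<ge> K \<Longrightarrow> g k = 0"
  shows "(\<Sum>k<N + K. (norm (star_product a g k))\<^sup>2) \<le> C\<^sup>2 * (\<Sum>k<N + K. (norm (g k))\<^sup>2)"
proof (cases "N + K = 0")
  case False
  define M where "M = N + K"
  then have M: "M > 0" "N \<le> M"
    using False by auto
  define c s where "c t h = (\<Sum>k<M. cos (t * real k) *\<^sub>R h k)" and "s t h = (\<Sum>k<M. sin (t * real k) *\<^sub>R h k)"
    for t and h :: "nat \<Rightarrow> quat"
  have conv: "(\<Sum>k<M. \<phi> k *\<^sub>R star_product a g k) = (\<Sum>m<M. \<Sum>l<M. \<phi> (m + l) *\<^sub>R (a m * g l))" for \<phi> :: "nat \<Rightarrow> real"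
  proof -
    have "(\<Sum>k<M. \<phi> k *\<^sub>R star_product a g k) = (\<Sum>k<M. \<Sum>m\<le>k. \<phi> (m + (k - m)) *\<^sub>R (a m * g (k - m)))"
      by (simp add: star_product_def scaleR_sum_right)
    also have "\<dots> = (\<Sum>m<M. \<Sum>l<M. \<phi> (m + l) *\<^sub>R (a m * g l))"
      by (rule sum_convolution_reindex[of N K]) (simp_all add: M_def a g)
    finally show ?thesis .
  qed
  have cc: "c t (star_product a g) = c t a * c t g - s t a * s t g" for t
    unfolding c_def s_def conv sum_product sum_subtractf[symmetric]
    by (intro sum.cong refl) (simp add: cos_add distrib_left algebra_simps)
  have ss: "s t (star_product a g) = c t a * s t g + s t a * c t g" for t
    unfolding c_def s_def conv sum_product sum.distrib[symmetric]
    by (intro sum.cong refl) (simp add: sin_add distrib_left algebra_simps)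
  have "norm (c t a + I * s t a) \<le> C" if I: "I \<in> imag_unit_sphere" for t I
  proof -
    have "c t a + I * s t a = (\<Sum>k<M. slice_of I (cis t) ^ k * a k)"
      unfolding c_def s_def sum_distrib_left sum.distrib[symmetric] slice_of_power[OF I, symmetric]
      by (intro sum.cong refl) (simp add: Complex.DeMoivre slice_of_def of_real_def distrib_right mult.commute[of t])
    also have "\<dots> = (\<Sum>k<N. slice_of I (cis t) ^ k * a k)"
      by (rule sum.mono_neutral_right) (use M a in auto)
    finally show ?thesis
      using bd[of "slice_of I (cis t)"] norm_slice_of[OF I] by simp
  qed
  then have "(norm (c t (star_product a g)))\<^sup>2 + (norm (s t (star_product a g)))\<^sup>2
      \<le> C\<^sup>2 * ((norm (c t g))\<^sup>2 + (norm (s t g))\<^sup>2)" for t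
    unfolding cc ss by (rule contractive_on_sphere)
  then have "(\<Sum>j<M. (norm (c (2 * pi * real j / real M) (star_product a g)))\<^sup>2 + (norm (s (2 * pi * real j / real M) (star_product a g)))\<^sup>2)
      \<le> (\<Sum>j<M. C\<^sup>2 * ((norm (c (2 * pi * real j / real M) g))\<^sup>2 + (norm (s (2 * pi * real j / real M) g))\<^sup>2))"
    by (rule sum_mono)
  then have "real M * (\<Sum>k<M. (norm (star_product a g k))\<^sup>2) \<le> C\<^sup>2 * (real M * (\<Sum>k<M. (norm (g k))\<^sup>2))"
    unfolding sum_distrib_left[symmetric] c_def s_def discrete_Parseval .
  then have "real M * (\<Sum>k<M. (norm (star_product a g k))\<^sup>2) \<le> real M * (C\<^sup>2 * (\<Sum>k<M. (norm (g k))\<^sup>2))"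
    by (simp add: algebra_simps)
  then have "(\<Sum>k<M. (norm (star_product a g k))\<^sup>2) \<le> C\<^sup>2 * (\<Sum>k<M. (norm (g k))\<^sup>2)"
    using M by simp
  then show ?thesis
    by (simp add: M_def)
qed simp

lemma power_series_abs_summable:
  fixes a :: "nat \<Rightarrow> quat"
  assumes "\<And>p. norm p < 1 \<Longrightarrow> (\<lambda>k. p ^ k * a k) sums f p" "0 \<le> r" "r < 1"
  shows "summable (\<lambda>k. r ^ k * norm (a k))"
proof -
  obtain R where R: "r < R" "R < 1"
    using dense assms by blast
  have "of_real R ^ k * a k = a k * of_real R ^ k" for k
    unfolding of_real_power[symmetric] by (rule of_real_commute_quat)
  then have "summable (\<lambda>k. a k * of_real R ^ k)"
    using sums_summable[OF assms(1)[of "of_real R"]] R assms(2) by simp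
  from powser_insidea[OF this, of "of_real r"] show ?thesis
    using R assms by (simp add: norm_mult norm_power mult.commute)
qed

text \<open>The dilated series \<open>p \<mapsto> f(r p)\<close>, cut off far out, is a polynomial that is bounded by \<open>1 + e\<close> on the
  unit sphere. The first \<open>K\<close> coefficients of a star product depend only on the first \<open>K\<close> coefficients
  of its factors, so the cut does not affect them and the limits \<open>e \<rightarrow> 0\<close>, \<open>r \<rightarrow> 1\<close> are those
  of finite sums.\<close>

lemma schur_star_product_contractive:
  fixes a g :: "nat \<Rightarrow> quat"
  assumes a: "\<And>p. norm p < 1 \<Longrightarrow> (\<lambda>k. p ^ k * a k) sums f p"
    and f: "\<And>p. norm p < 1 \<Longrightarrow> norm (f p) \<le> 1"
  shows "(\<Sum>k<K. (norm (star_product a g k))\<^sup>2) \<le> (\<Sum>k<K. (norm (g k))\<^sup>2)"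
proof -
  define G where "G = (\<Sum>k<K. (norm (g k))\<^sup>2)"
  have dilated: "(\<Sum>k<K. (norm (star_product (\<lambda>m. r ^ m *\<^sub>R a m) g k))\<^sup>2) \<le> (1 + e)\<^sup>2 * G"
    if r: "0 < r" "r < 1" and e: "e > 0" for r e
  proof -
    have sm: "summable (\<lambda>k. r ^ k * norm (a k))"
      using power_series_abs_summable[OF a] r by simp
    have "(\<lambda>n. \<Sum>i. r ^ (i + n) * norm (a (i + n))) \<longlonglongrightarrow> 0"
      using suminf_exist_split2[OF sm] .
    then have "\<forall>\<^sub>F n in sequentially. (\<Sum>i. r ^ (i + n) * norm (a (i + n))) < e"
      using e by (rule order_tendstoD)
    then have "\<forall>\<^sub>F n in sequentially. (\<Sum>i. r ^ (i + n) * norm (a (i + n))) < e \<and> K \<le> n"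
      by (intro eventually_conj eventually_ge_at_top)
    then obtain N where N: "(\<Sum>i. r ^ (i + N) * norm (a (i + N))) < e" "N \<ge> K"
      using eventually_happens'[OF sequentially_bot] by blast
    define a' g' where "a' k = (if k < N then r ^ k *\<^sub>R a k else 0)"
      and "g' k = (if k < K then g k else 0)" for k
    have "norm (\<Sum>k<N. p ^ k * a' k) \<le> 1 + e" if p: "norm p = 1" for p
    proof -
      define q where "q = of_real r * p"
      have q: "norm q < 1" "norm q = r"
        using r p by (simp_all add: q_def norm_mult)
      have pw: "p ^ k * (r ^ k *\<^sub>R a k) = q ^ k * a k" for k
      proof -
        have "q ^ k = r ^ k *\<^sub>R p ^ k"
          unfolding q_def scaleR_conv_of_real[symmetric] by simp
        then show ?thesis
          by simp
      qed
      have "(\<Sum>k<N. p ^ k * a' k) = (\<Sum>k<N. q ^ k * a k)"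
        using pw by (intro sum.cong refl) (simp add: a'_def)
      also have "\<dots> = f q - (\<Sum>i. q ^ (i + N) * a (i + N))"
        using a[OF q(1)] suminf_minus_initial_segment[of "\<lambda>k. q ^ k * a k" N] by (auto simp: sums_iff)
      also have "norm \<dots> \<le> norm (f q) + norm (\<Sum>i. q ^ (i + N) * a (i + N))"
        by (rule norm_triangle_ineq4)
      also have "norm (\<Sum>i. q ^ (i + N) * a (i + N)) \<le> (\<Sum>i. r ^ (i + N) * norm (a (i + N)))"
        using sm by (intro norm_suminf_le) (simp_all add: norm_mult norm_power q summable_iff_shift[where f = "\<lambda>k. r ^ k * norm (a k)"])
      finally show ?thesis
        using f[OF q(1)] N by simp
    qed
    then have "(\<Sum>k<N + K. (norm (star_product a' g' k))\<^sup>2) \<le> (1 + e)\<^sup>2 * (\<Sum>k<N + K. (norm (g' k))\<^sup>2)"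
      by (intro polynomial_star_product_bound) (auto simp: a'_def g'_def)
    also have "(\<Sum>k<N + K. (norm (g' k))\<^sup>2) = (\<Sum>k<K. (norm (g' k))\<^sup>2)"
      by (rule sum.mono_neutral_right) (auto simp: g'_def)
    also have "\<dots> = G"
      by (simp add: G_def g'_def)
    finally have "(\<Sum>k<N + K. (norm (star_product a' g' k))\<^sup>2) \<le> (1 + e)\<^sup>2 * G" .
    moreover have "(\<Sum>k<K. (norm (star_product a' g' k))\<^sup>2) \<le> (\<Sum>k<N + K. (norm (star_product a' g' k))\<^sup>2)"
      by (rule sum_mono2) auto
    moreover have "star_product a' g' k = star_product (\<lambda>m. r ^ m *\<^sub>R a m) g k" if "k < K" for k
      unfolding star_product_def using that N by (intro sum.cong refl) (auto simp: a'_def g'_def)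
    ultimately show ?thesis
      by simp
  qed
  have dilated': "(\<Sum>k<K. (norm (star_product (\<lambda>m. r ^ m *\<^sub>R a m) g k))\<^sup>2) \<le> G" if r: "0 < r" "r < 1" for r
  proof (rule tendsto_lowerbound)
    show "((\<lambda>e. (1 + e)\<^sup>2 * G) \<longlongrightarrow> G) (at_right 0)"
      by (auto intro!: tendsto_eq_intros)
    show "\<forall>\<^sub>F e in at_right 0. (\<Sum>k<K. (norm (star_product (\<lambda>m. r ^ m *\<^sub>R a m) g k))\<^sup>2) \<le> (1 + e)\<^sup>2 * G"
      using dilated[OF r] by (auto simp: eventually_at_right_field intro!: exI[of _ 1])
  qed simp
  have "(\<Sum>k<K. (norm (star_product a g k))\<^sup>2) \<le> G"
  proof (rule tendsto_upperbound)
    show "((\<lambda>r. \<Sum>k<K. (norm (star_product (\<lambda>m. r ^ m *\<^sub>R a m) g k))\<^sup>2) \<longlongrightarrow> (\<Sum>k<K. (norm (star_product a g k))\<^sup>2)) (at_left 1)"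
      unfolding star_product_def by (auto intro!: tendsto_eq_intros)
    show "\<forall>\<^sub>F r in at_left 1. (\<Sum>k<K. (norm (star_product (\<lambda>m. r ^ m *\<^sub>R a m) g k))\<^sup>2) \<le> G"
      using dilated' by (auto simp: eventually_at_left_field intro!: exI[of _ 0])
  qed simp
  then show ?thesis
    by (simp add: G_def)
qed

text \<open>The adjoint of the leading \<open>K \<times> K\<close> section of star multiplication by \<open>a\<close>.\<close>

definition star_adjoint :: "(nat \<Rightarrow> quat) \<Rightarrow> nat \<Rightarrow> (nat \<Rightarrow> quat) \<Rightarrow> nat \<Rightarrow> quat" where
  "star_adjoint a K f k = (\<Sum>m<K - k. qcnj (a m) * f (k + m))"

lemma star_adjoint_inner:
  "(\<Sum>k<K. inner (h k) (star_adjoint a K f k)) = (\<Sum>k<K. inner (star_product a h k) (f k))"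
proof -
  have "(\<Sum>k<K. inner (h k) (star_adjoint a K f k)) = (\<Sum>k<K. \<Sum>m<K - k. inner (a m * h k) (f (m + k)))"
    by (simp add: star_adjoint_def inner_sum_right inner_mult_qcnj add.commute)
  also have "\<dots> = (\<Sum>(k, m)\<in>(SIGMA k:{..<K}. {..<K - k}). inner (a m * h k) (f (m + k)))"
    by (rule sum.Sigma) auto
  also have "\<dots> = (\<Sum>(m, k)\<in>{(m, k). m + k < K}. inner (a m * h k) (f (m + k)))"
    by (rule sum.reindex_bij_witness[of _ prod.swap prod.swap]) (auto simp: prod.swap_def)
  also have "\<dots> = (\<Sum>k<K. \<Sum>m\<le>k. inner (a m * h (k - m)) (f (m + (k - m))))"
    by (rule sum.triangle_reindex)
  also have "\<dots> = (\<Sum>k<K. inner (star_product a h k) (f k))"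
    by (simp add: star_product_def inner_sum_left)
  finally show ?thesis .
qed

lemma two_inner_le: "2 * inner x y \<le> (norm x)\<^sup>2 + (norm y)\<^sup>2"
proof -
  have "0 \<le> (norm (x - y))\<^sup>2"
    by simp
  then show ?thesis
    unfolding power2_norm_eq_inner by (simp add: inner_diff inner_commute)
qed

text \<open>For \<open>h = T\<^sup>* f\<close> one has \<open>2 \<parallel>h\<parallel>\<^sup>2 = 2 \<langle>T h, f\<rangle> \<le> \<parallel>T h\<parallel>\<^sup>2 + \<parallel>f\<parallel>\<^sup>2 \<le> \<parallel>h\<parallel>\<^sup>2 + \<parallel>f\<parallel>\<^sup>2\<close>.\<close>

lemma schur_adjoint_contractive:
  assumes "\<And>g. (\<Sum>k<K. (norm (star_product a g k))\<^sup>2) \<le> (\<Sum>k<K. (norm (g k))\<^sup>2)"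
  shows "(\<Sum>k<K. (norm (star_adjoint a K f k))\<^sup>2) \<le> (\<Sum>k<K. (norm (f k))\<^sup>2)"
proof -
  define h where "h = star_adjoint a K f"
  have "2 * (\<Sum>k<K. (norm (h k))\<^sup>2) = (\<Sum>k<K. 2 * inner (star_product a h k) (f k))"
    using star_adjoint_inner[where K = K and h = h and a = a and f = f] by (simp add: h_def power2_norm_eq_inner sum_distrib_left)
  also have "\<dots> \<le> (\<Sum>k<K. (norm (star_product a h k))\<^sup>2 + (norm (f k))\<^sup>2)"
    by (intro sum_mono two_inner_le)
  also have "\<dots> \<le> (\<Sum>k<K. (norm (h k))\<^sup>2) + (\<Sum>k<K. (norm (f k))\<^sup>2)"
    using assms[of h] by (simp add: sum.distrib)
  finally show ?thesis
    by (simp add: h_def)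
qed

section \<open>The Pick matrix as a difference of norms\<close>

text \<open>The case \<open>w = 1\<close> is a combination of conjugated powers of the nodes. The case where \<open>w\<close> consists of
  the values to be interpolated is its image under the adjoint of star multiplication by a solution.\<close>

definition node_seq :: "('n \<Rightarrow> quat) \<Rightarrow> ('n \<Rightarrow> quat) \<Rightarrow> quat ^ 'n \<Rightarrow> nat \<Rightarrow> quat" where
  "node_seq p w c k = (\<Sum>j\<in>UNIV. qcnj (w j) * qcnj (p j) ^ k * c $ j)"

lemma summable_kernel:
  assumes "norm p < 1" "norm q < 1"
  shows "summable (\<lambda>k. p ^ k * (m::quat) * qcnj q ^ k)"
proof (rule summable_comparison_test')
  show "summable (\<lambda>k. norm p ^ k * norm m)"
    using assms(1) by (simp add: summable_mult2 summable_geometric)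
  fix k
  have "norm p ^ k * norm m * norm q ^ k \<le> norm p ^ k * norm m * 1"
    using assms(2) by (intro mult_left_mono power_le_one) auto
  then show "norm (p ^ k * m * qcnj q ^ k) \<le> norm p ^ k * norm m"
    by (simp add: norm_mult norm_power)
qed

lemma kernel_form_sums:
  assumes "\<And>i. norm (p i) < 1"
  shows "(\<lambda>k. \<Sum>i\<in>UNIV. \<Sum>j\<in>UNIV. qcnj (c $ i) * (p i ^ k * m i j * qcnj (p j) ^ k) * c $ j)
     sums (\<Sum>i\<in>UNIV. \<Sum>j\<in>UNIV. qcnj (c $ i) * (\<Sum>k. p i ^ k * m i j * qcnj (p j) ^ k) * c $ j)"
  by (intro sums_sum sums_mult sums_mult2 summable_sums summable_kernel assms)

lemma node_seq_norm_sq: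
  "of_real ((norm (node_seq p w c k))\<^sup>2)
    = (\<Sum>i\<in>UNIV. \<Sum>j\<in>UNIV. qcnj (c $ i) * (p i ^ k * (w i * qcnj (w j)) * qcnj (p j) ^ k) * c $ j)"
  unfolding mult_qcnj_self(2)[symmetric] node_seq_def qcnj_sum sum_product
  by (simp add: mult.assoc)

lemma node_seq_sq_sums:
  assumes "\<And>i. norm (p i) < 1"
  shows "(\<lambda>k. of_real ((norm (node_seq p w c k))\<^sup>2)) sums
    (\<Sum>i\<in>UNIV. \<Sum>j\<in>UNIV. qcnj (c $ i) * (\<Sum>k. p i ^ k * (w i * qcnj (w j)) * qcnj (p j) ^ k) * c $ j)"
  unfolding node_seq_norm_sq by (rule kernel_form_sums[OF assms])

lemma summable_node_seq_sq:
  assumes "\<And>i. norm (p i) < 1"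
  shows "summable (\<lambda>k. (norm (node_seq p w c k))\<^sup>2)"
  using bounded_linear.summable[OF bounded_linear_qre
      sums_summable[OF node_seq_sq_sums[where p = p and w = w and c = c, OF assms]]]
  by (simp only: quat_of_real_sel)

definition node_norm :: "('n \<Rightarrow> quat) \<Rightarrow> ('n \<Rightarrow> quat) \<Rightarrow> quat ^ 'n \<Rightarrow> real" where
  "node_norm p w c = (\<Sum>k. (norm (node_seq p w c k))\<^sup>2)"

lemma of_real_node_norm:
  assumes "\<And>i. norm (p i) < 1"
  shows "of_real (node_norm p w c) =
    (\<Sum>i\<in>UNIV. \<Sum>j\<in>UNIV. qcnj (c $ i) * (\<Sum>k. p i ^ k * (w i * qcnj (w j)) * qcnj (p j) ^ k) * c $ j)"
proof -
  have "(\<lambda>k. of_real ((norm (node_seq p w c k))\<^sup>2)) sums (of_real (node_norm p w c) :: quat)"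
    unfolding node_norm_def
    by (intro bounded_linear.sums[OF bounded_linear_of_real] summable_sums summable_node_seq_sq assms)
  then show ?thesis
    by (rule sums_unique2[OF _ node_seq_sq_sums[OF assms]])
qed

definition hermitian_form :: "quat ^ 'n ^ 'n \<Rightarrow> quat ^ 'n \<Rightarrow> quat" where
  "hermitian_form A c = (\<Sum>i\<in>UNIV. qcnj (c $ i) * (A *v c) $ i)"

lemma hermitian_form_alt: "hermitian_form A c = (\<Sum>i\<in>UNIV. \<Sum>j\<in>UNIV. qcnj (c $ i) * A $ i $ j * c $ j)"
  by (simp add: hermitian_form_def matrix_vector_mult_def sum_distrib_left mult.assoc)

lemma pick_matrix_entry_split:
  assumes "\<And>i. norm (p i) < 1"
  shows "pick_matrix p s $ i $ j = (\<Sum>k. p i ^ k * (1 * qcnj 1) * qcnj (p j) ^ k)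
      - (\<Sum>k. p i ^ k * (s i * qcnj (s j)) * qcnj (p j) ^ k)"
proof -
  have "(\<Sum>k. p i ^ k * (1 * qcnj 1) * qcnj (p j) ^ k) - (\<Sum>k. p i ^ k * (s i * qcnj (s j)) * qcnj (p j) ^ k)
    = (\<Sum>k. p i ^ k * (1 * qcnj 1) * qcnj (p j) ^ k - p i ^ k * (s i * qcnj (s j)) * qcnj (p j) ^ k)"
    by (rule suminf_diff[OF summable_kernel summable_kernel]) (rule assms)+
  then show ?thesis
    unfolding pick_matrix_def by (simp add: right_diff_distrib left_diff_distrib mult.assoc)
qed

lemma hermitian_form_pick_matrix:
  assumes "\<And>i. norm (p i) < 1"
  shows "hermitian_form (pick_matrix p s) c = of_real (node_norm p (\<lambda>_. 1) c - node_norm p s c)"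
  unfolding hermitian_form_alt pick_matrix_entry_split[OF assms] of_real_diff of_real_node_norm[OF assms]
    right_diff_distrib left_diff_distrib sum_subtractf ..

lemma pick_matrix_hermitian:
  assumes "\<And>i. norm (p i) < 1"
  shows "pick_matrix p s $ i $ j = qcnj (pick_matrix p s $ j $ i)"
proof -
  have "(\<lambda>k. qcnj (p j ^ k * (1 - s j * qcnj (s i)) * qcnj (p i) ^ k)) sums
      qcnj (\<Sum>k. p j ^ k * (1 - s j * qcnj (s i)) * qcnj (p i) ^ k)"
    by (intro bounded_linear.sums[OF bounded_linear_qcnj] summable_sums summable_kernel assms)
  then show ?thesis
    by (simp add: pick_matrix_def sums_iff mult.assoc)
qed

text \<open>By \<open>hermitian_form_pick_matrix\<close>, the form of the Pick matrix is the norm lost when passing from the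
  sequence with \<open>w = 1\<close> to the sequence with \<open>w = s\<close>.\<close>

lemma psd_pick_matrix_iff:
  assumes "\<And>i. norm (p i) < 1"
  shows "psd_quat_matrix (pick_matrix p s) \<longleftrightarrow> (\<forall>c. node_norm p s c \<le> node_norm p (\<lambda>_. 1) c)"
proof -
  have "of_real x \<in> (\<real>\<^sub>\<ge>\<^sub>0 :: quat set) \<longleftrightarrow> x \<ge> 0" for x
    by (rule nonneg_Reals_of_real_iff)
  moreover have "psd_quat_matrix (pick_matrix p s) \<longleftrightarrow> (\<forall>c. hermitian_form (pick_matrix p s) c \<in> \<real>\<^sub>\<ge>\<^sub>0)"
    unfolding psd_quat_matrix_def hermitian_form_def
    using pick_matrix_hermitian[where p = p and s = s, OF assms] by blast
  ultimately show ?thesis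
    unfolding hermitian_form_pick_matrix[where p = p, OF assms] by (simp del: of_real_diff)
qed

text \<open>Conjugated powers of a point are eigenvectors of the adjoint of star multiplication, with the
  conjugated value at that point as eigenvalue. The finite sections reach this in the limit.\<close>

lemma star_adjoint_node_seq_tendsto:
  assumes "\<And>j. (\<lambda>m. p j ^ m * a m) sums s j"
  shows "(\<lambda>K. star_adjoint a K (node_seq p (\<lambda>_. 1) c) k) \<longlonglongrightarrow> node_seq p s c k"
proof -
  have eq: "star_adjoint a K (node_seq p (\<lambda>_. 1) c) k
      = (\<Sum>j\<in>UNIV. (\<Sum>m<K - k. qcnj (p j ^ m * a m)) * qcnj (p j) ^ k * c $ j)" for K
    unfolding star_adjoint_def node_seq_def sum_distrib_left sum_distrib_right
    by (subst sum.swap) (simp add: mult.assoc add.commute[of k] power_add)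
  have "(\<lambda>K. \<Sum>m<K - k. qcnj (p j ^ m * a m)) \<longlonglongrightarrow> qcnj (s j)" for j
  proof -
    have "(\<lambda>K. \<Sum>m<K. qcnj (p j ^ m * a m)) \<longlonglongrightarrow> qcnj (s j)"
      using bounded_linear.sums[OF bounded_linear_qcnj assms[of j]] by (simp only: sums_def)
    then show ?thesis
      by (rule filterlim_compose[OF _ filterlim_minus_const_nat_at_top])
  qed
  then show ?thesis
    unfolding eq node_seq_def by (intro tendsto_sum tendsto_mult tendsto_const)
qed

context
  fixes p s :: "'n::finite \<Rightarrow> quat" and a :: "nat \<Rightarrow> quat"
  assumes p: "\<And>i. norm (p i) < 1"
    and contr: "\<And>K g. (\<Sum>k<K. (norm (star_product a g k))\<^sup>2) \<le> (\<Sum>k<K. (norm (g k))\<^sup>2)"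
    and interp: "\<And>j. (\<lambda>m. p j ^ m * a m) sums s j"
begin

lemma sum_node_seq_sq_le: "(\<Sum>k<K. (norm (node_seq p w c k))\<^sup>2) \<le> node_norm p w c"
  unfolding node_norm_def by (intro sum_le_suminf summable_node_seq_sq p) auto

lemma star_adjoint_node_seq_bound:
  assumes "N \<le> K"
  shows "(\<Sum>k<N. (norm (star_adjoint a K (node_seq p (\<lambda>_. 1) c) k))\<^sup>2) \<le> node_norm p (\<lambda>_. 1) c"
proof -
  have "(\<Sum>k<N. (norm (star_adjoint a K (node_seq p (\<lambda>_. 1) c) k))\<^sup>2)
      \<le> (\<Sum>k<K. (norm (star_adjoint a K (node_seq p (\<lambda>_. 1) c) k))\<^sup>2)"
    using assms by (intro sum_mono2) auto
  also have "\<dots> \<le> (\<Sum>k<K. (norm (node_seq p (\<lambda>_. 1) c k))\<^sup>2)"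
    by (rule schur_adjoint_contractive[OF contr])
  also have "\<dots> \<le> node_norm p (\<lambda>_. 1) c"
    by (rule sum_node_seq_sq_le)
  finally show ?thesis .
qed

lemma node_norm_le: "node_norm p s c \<le> node_norm p (\<lambda>_. 1) c"
  unfolding node_norm_def[of p s]
proof (rule suminf_le_const[OF summable_node_seq_sq[OF p]])
  fix N
  show "(\<Sum>k<N. (norm (node_seq p s c k))\<^sup>2) \<le> node_norm p (\<lambda>_. 1) c"
  proof (rule tendsto_upperbound)
    show "(\<lambda>K. \<Sum>k<N. (norm (star_adjoint a K (node_seq p (\<lambda>_. 1) c) k))\<^sup>2)
        \<longlonglongrightarrow> (\<Sum>k<N. (norm (node_seq p s c k))\<^sup>2)"
      by (intro tendsto_sum tendsto_power tendsto_norm star_adjoint_node_seq_tendsto interp)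
    show "\<forall>\<^sub>F K in sequentially. (\<Sum>k<N. (norm (star_adjoint a K (node_seq p (\<lambda>_. 1) c) k))\<^sup>2)
        \<le> node_norm p (\<lambda>_. 1) c"
      using eventually_ge_at_top[of N] by eventually_elim (rule star_adjoint_node_seq_bound)
  qed simp
qed

lemma summable_norm_node_seq: "summable (\<lambda>k. norm (node_seq p w c k))"
proof (rule summable_comparison_test')
  show "summable (\<lambda>k. \<Sum>j\<in>UNIV. norm (w j) * norm (p j) ^ k * norm (c $ j))"
    using p by (intro summable_sum summable_mult summable_mult2 summable_geometric) auto
  show "norm (norm (node_seq p w c k)) \<le> (\<Sum>j\<in>UNIV. norm (w j) * norm (p j) ^ k * norm (c $ j))" for k
    unfolding node_seq_def by (auto intro!: sum_norm_le simp: norm_mult norm_power)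
qed

text \<open>With \<open>\<parallel>f\<parallel> = \<parallel>g\<parallel>\<close> and \<open>T\<^sup>* f = g\<close>, expanding the square gives
  \<open>\<parallel>f - T g\<parallel>\<^sup>2 = \<parallel>f\<parallel>\<^sup>2 - 2 \<langle>T\<^sup>* f, g\<rangle> + \<parallel>T g\<parallel>\<^sup>2 \<le> \<parallel>f\<parallel>\<^sup>2 - \<parallel>g\<parallel>\<^sup>2 = 0\<close>. The proof runs this computation on finite
  sections; their bound \<open>E K\<close> tends to zero by Tannery's theorem.\<close>

lemma star_product_node_seq:
  assumes eq: "node_norm p s c = node_norm p (\<lambda>_. 1) c"
  shows "star_product a (node_seq p s c) = node_seq p (\<lambda>_. 1) c"
proof
  fix k
  define f g where "f = node_seq p (\<lambda>_. 1) c" and "g = node_seq p s c"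
  define N where "N = node_norm p (\<lambda>_. 1) c"
  define E where "E K = (\<Sum>k<K. (norm (f k))\<^sup>2) - 2 * (\<Sum>k<K. inner (g k) (star_adjoint a K f k))
      + (\<Sum>k<K. (norm (g k))\<^sup>2)" for K
  have "norm (star_adjoint a K f k) \<le> sqrt N" if "k < K" for k K
  proof -
    have "(norm (star_adjoint a K f k))\<^sup>2 \<le> (\<Sum>k<K. (norm (star_adjoint a K f k))\<^sup>2)"
      using that by (intro member_le_sum) auto
    also have "\<dots> \<le> N"
      unfolding N_def f_def by (rule star_adjoint_node_seq_bound) simp
    finally show ?thesis
      by (rule real_le_rsqrt)
  qed
  then have bound: "norm (inner (g k) (star_adjoint a K f k)) \<le> norm (g k) * sqrt N" if "k < K" for k K
    using that by (intro order_trans[OF Cauchy_Schwarz_ineq2[folded real_norm_def]] mult_left_mono) auto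
  have "(\<lambda>K. \<Sum>k<K. inner (g k) (star_adjoint a K f k)) \<longlonglongrightarrow> (\<Sum>k. inner (g k) (g k))"
  proof -
    define \<phi> where "\<phi> k K = (if k < K then inner (g k) (star_adjoint a K f k) else 0)" for k K
    have "(\<lambda>K. \<Sum>k. \<phi> k K) \<longlonglongrightarrow> (\<Sum>k. inner (g k) (g k))"
    proof (rule tannerys_theorem[THEN conjunct2, THEN conjunct2])
      show "\<phi> k \<longlonglongrightarrow> inner (g k) (g k)" for k
      proof (rule Lim_transform_eventually)
        show "(\<lambda>K. inner (g k) (star_adjoint a K f k)) \<longlonglongrightarrow> inner (g k) (g k)"
          unfolding f_def g_def by (intro tendsto_inner tendsto_const star_adjoint_node_seq_tendsto interp)
        show "\<forall>\<^sub>F K in sequentially. inner (g k) (star_adjoint a K f k) = \<phi> k K"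
          using eventually_gt_at_top[of k] by eventually_elim (simp add: \<phi>_def)
      qed
      have "norm (\<phi> k K) \<le> norm (g k) * sqrt N" for k K
        using bound[of k K] order_trans[OF norm_ge_zero[of "inner (g k) (star_adjoint a (Suc k) f k)"] bound[of k "Suc k"]]
        by (simp add: \<phi>_def)
      then show "\<forall>\<^sub>F (k, K) in at_top \<times>\<^sub>F sequentially. norm (\<phi> k K) \<le> norm (g k) * sqrt N"
        by (intro always_eventually) auto
      show "summable (\<lambda>k. norm (g k) * sqrt N)"
        unfolding g_def by (intro summable_mult2 summable_norm_node_seq)
    qed simp
    moreover have "(\<Sum>k. \<phi> k K) = (\<Sum>k<K. inner (g k) (star_adjoint a K f k))" for K
      using suminf_finite[of "{..<K}" "\<lambda>k. \<phi> k K"] by (simp add: \<phi>_def)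
    ultimately show ?thesis
      by simp
  qed
  then have "E \<longlonglongrightarrow> N - 2 * node_norm p s c + node_norm p s c"
    unfolding E_def N_def f_def g_def node_norm_def power2_norm_eq_inner
    using summable_node_seq_sq[OF p, unfolded power2_norm_eq_inner]
    by (intro tendsto_add tendsto_diff tendsto_mult tendsto_const summable_LIMSEQ)
  then have lim: "E \<longlonglongrightarrow> 0"
    using eq by (simp add: N_def)
  have "(norm (f k - star_product a g k))\<^sup>2 \<le> E K" if "k < K" for K
  proof -
    have "(norm (f k - star_product a g k))\<^sup>2 \<le> (\<Sum>k<K. (norm (f k - star_product a g k))\<^sup>2)"
      using that by (intro member_le_sum) auto
    also have "\<dots> = (\<Sum>k<K. (norm (f k))\<^sup>2) - 2 * (\<Sum>k<K. inner (star_product a g k) (f k))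
        + (\<Sum>k<K. (norm (star_product a g k))\<^sup>2)"
      unfolding sum_distrib_left sum_subtractf[symmetric] sum.distrib[symmetric] power2_norm_eq_inner
      by (intro sum.cong refl) (simp add: inner_diff inner_commute)
    also have "\<dots> \<le> E K"
      unfolding E_def star_adjoint_inner using contr[of g K] by simp
    finally show ?thesis .
  qed
  then have "(norm (f k - star_product a g k))\<^sup>2 \<le> 0"
    by (intro tendsto_lowerbound[OF lim]) (auto simp: eventually_sequentially intro!: exI[of _ "Suc k"])
  then show "star_product a (node_seq p s c) k = node_seq p (\<lambda>_. 1) c k"
    by (simp add: f_def g_def)
qed

end

text \<open>If \<open>l\<close> is the first index with \<open>g l \<noteq> 0\<close>, then entry \<open>n + l\<close> of the product determines the coefficient
  with index \<open>n\<close> from the previous ones.\<close>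

lemma star_product_right_cancel:
  assumes eq: "star_product a g = star_product b g" and g: "g \<noteq> (\<lambda>_. 0)"
  shows "a = b"
proof
  fix n
  define l where "l = (LEAST l. g l \<noteq> 0)"
  have gl: "g l \<noteq> 0"
    unfolding l_def using g by (metis (mono_tags, lifting) LeastI ext)
  have gz: "g m = 0" if "m < l" for m
    using not_less_Least that unfolding l_def by blast
  show "a n = b n"
  proof (induction n rule: less_induct)
    case (less n)
    have "(\<Sum>m\<le>n + l. (a m - b m) * g (n + l - m)) = 0"
      using fun_cong[OF eq, of "n + l"] by (simp add: star_product_def left_diff_distrib sum_subtractf)
    moreover have "(\<Sum>m\<le>n + l. (a m - b m) * g (n + l - m)) = (\<Sum>m\<in>{n}. (a m - b m) * g (n + l - m))"
    proof (rule sum.mono_neutral_right)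
      show "\<forall>m\<in>{..n + l} - {n}. (a m - b m) * g (n + l - m) = 0"
      proof
        fix m assume "m \<in> {..n + l} - {n}"
        then consider "m < n" | "n + l - m < l"
          by force
        then show "(a m - b m) * g (n + l - m) = 0"
          by cases (auto simp: less gz)
      qed
    qed auto
    ultimately show ?case
      using gl by simp
  qed
qed

text \<open>For quaternions with equal real parts, equal norms and imaginary parts of equal length are the same
  condition, so that this is equivalence of quaternions.\<close>

definition same_sphere :: "quat \<Rightarrow> quat \<Rightarrow> bool" where
  "same_sphere p q \<longleftrightarrow> qre p = qre q \<and> norm p = norm q"

text \<open>Let \<open>u\<close> and \<open>v\<close> be the imaginary parts. As \<open>u\<^sup>2 = v\<^sup>2\<close> is real, \<open>h = v y + y u\<close> satisfies \<open>h u = v h\<close> for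
  every \<open>y\<close>. If all these \<open>h\<close> vanish, then \<open>v = - u\<close> and \<open>u\<close> commutes with all quaternions, so both
  are zero.\<close>

lemma same_sphere_imp_quat_equiv:
  assumes "same_sphere p q"
  shows "quat_equiv p q"
proof -
  define u v where "u = p - of_real (qre p)" and "v = q - of_real (qre q)"
  have "(norm p)\<^sup>2 = (norm q)\<^sup>2"
    using assms by (simp add: same_sphere_def)
  then have sq: "u * u = v * v"
    using assms unfolding norm_quat_sq
    by (simp add: u_def v_def quat_eq_iff same_sphere_def power2_eq_square)
  have "u * u = of_real (- ((qi u)\<^sup>2 + (qj u)\<^sup>2 + (qk u)\<^sup>2))"
    by (simp add: u_def quat_eq_iff power2_eq_square)
  then have comm: "y * (u * u) = u * u * y" for y
    using of_real_commute_quat by metis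
  have "\<exists>h. h \<noteq> 0 \<and> h * u = v * h"
  proof (cases "\<exists>y. v * y + y * u \<noteq> 0")
    case True
    then obtain y where y: "v * y + y * u \<noteq> 0" ..
    have "y * u * u = v * v * y"
      using sq comm[of y] by (simp only: mult.assoc)
    then have "(v * y + y * u) * u = v * (v * y + y * u)"
      by (simp add: distrib_left distrib_right mult.assoc)
    with y show ?thesis
      by blast
  next
    case False
    then have F: "v * y + y * u = 0" for y
      by blast
    have "v = - u"
      using F[of 1] by (simp add: eq_neg_iff_add_eq_0)
    then have "y * u = u * y" for y
      using F[of y] by simp
    from this[of "Quat 0 1 0 0"] this[of "Quat 0 0 1 0"] have "u = 0"
      by (simp add: quat_eq_iff u_def)
    with \<open>v = - u\<close> show ?thesis
      by (intro exI[of _ 1]) simp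
  qed
  then obtain h where h: "h \<noteq> 0" "h * u = v * h"
    by blast
  have "h * p = q * h"
  proof -
    have "h * p = h * u + h * of_real (qre p)" "q * h = v * h + of_real (qre q) * h"
      by (simp_all add: u_def v_def right_diff_distrib left_diff_distrib)
    then show ?thesis
      using h assms of_real_commute_quat[of "qre q" h] by (simp add: same_sphere_def)
  qed
  then have "p = inverse h * q * h"
    using h(1) by (metis left_inverse mult.assoc mult_1)
  with h(1) show ?thesis
    unfolding quat_equiv_def by blast
qed

text \<open>The real quadratic polynomial of the sphere through \<open>q\<close>.\<close>

lemma sphere_polynomial_eq_0_iff:
  "x * x - (2 * qre q) *\<^sub>R x + (norm q)\<^sup>2 *\<^sub>R 1 = 0 \<longleftrightarrow> same_sphere x q"
proof
  assume "same_sphere x q"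
  then have "qre x = qre q" "(norm q)\<^sup>2 = (norm x)\<^sup>2"
    by (simp_all add: same_sphere_def)
  then show "x * x - (2 * qre q) *\<^sub>R x + (norm q)\<^sup>2 *\<^sub>R 1 = 0"
    unfolding norm_quat_sq[of x] by (simp add: quat_eq_iff power2_eq_square algebra_simps)
next
  assume 0: "x * x - (2 * qre q) *\<^sub>R x + (norm q)\<^sup>2 *\<^sub>R 1 = 0"
  have im: "(qre x - qre q) * qi x = 0" "(qre x - qre q) * qj x = 0" "(qre x - qre q) * qk x = 0"
    using 0 by (simp_all add: quat_eq_iff algebra_simps)
  have re: "(qre x)\<^sup>2 - ((qi x)\<^sup>2 + (qj x)\<^sup>2 + (qk x)\<^sup>2) - 2 * qre q * qre x + (norm q)\<^sup>2 = 0"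
    using 0 by (simp add: quat_eq_iff algebra_simps power2_eq_square)
  have "qre x = qre q"
  proof (rule ccontr)
    assume ne: "qre x \<noteq> qre q"
    then have "qi x = 0" "qj x = 0" "qk x = 0"
      using im by simp_all
    then have "(qre x - qre q)\<^sup>2 + ((qi q)\<^sup>2 + (qj q)\<^sup>2 + (qk q)\<^sup>2) = 0"
      using re unfolding norm_quat_sq[of q] by (simp add: power2_eq_square algebra_simps)
    moreover have "(qre x - qre q)\<^sup>2 > 0"
      using ne by simp
    moreover have "(qi q)\<^sup>2 + (qj q)\<^sup>2 + (qk q)\<^sup>2 \<ge> 0"
      by simp
    ultimately show False
      by linarith
  qed
  moreover from this re have "(norm x)\<^sup>2 = (norm q)\<^sup>2"
    unfolding norm_quat_sq[of x] by (simp add: power2_eq_square algebra_simps)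
  then have "norm x = norm q"
    by simp
  ultimately show "same_sphere x q"
    by (simp add: same_sphere_def)
qed

text \<open>\<open>F\<close> is the product of the real quadratic polynomials of the spheres through the points of \<open>L\<close>.
  Each factor acts on the relations \<open>\<Sum>\<^sub>j d\<^sub>j p\<^sub>j\<^sup>k = 0\<close> as a combination of shifts in \<open>k\<close>, so it can be
  inserted without destroying them.\<close>

lemma spheres_annihilated:
  fixes p d :: "'n::finite \<Rightarrow> quat"
  assumes "finite L" "\<And>k. (\<Sum>j\<in>UNIV. d j * p j ^ k) = 0"
  shows "\<exists>F. (\<forall>x. F x = 0 \<longleftrightarrow> (\<exists>l\<in>L. same_sphere x l)) \<and> (\<forall>k. (\<Sum>j\<in>UNIV. d j * F (p j) * p j ^ k) = 0)"
  using assms(1)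
proof (induction L rule: finite_induct)
  case empty
  show ?case
    using assms(2) by (intro exI[of _ "\<lambda>_. 1"]) simp
next
  case (insert q L)
  then obtain F where F: "\<And>x. F x = 0 \<longleftrightarrow> (\<exists>l\<in>L. same_sphere x l)"
      "\<And>k. (\<Sum>j\<in>UNIV. d j * F (p j) * p j ^ k) = 0"
    by blast
  define G where "G x = x * x - (2 * qre q) *\<^sub>R x + (norm q)\<^sup>2 *\<^sub>R 1" for x :: quat
  have "(\<Sum>j\<in>UNIV. d j * (F (p j) * G (p j)) * p j ^ k)
      = (\<Sum>j\<in>UNIV. d j * F (p j) * p j ^ (k + 2)) - (2 * qre q) *\<^sub>R (\<Sum>j\<in>UNIV. d j * F (p j) * p j ^ (k + 1))
        + (norm q)\<^sup>2 *\<^sub>R (\<Sum>j\<in>UNIV. d j * F (p j) * p j ^ k)" for k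
    unfolding scaleR_sum_right sum_subtractf[symmetric] sum.distrib[symmetric]
    by (intro sum.cong refl) (simp add: G_def distrib_left right_diff_distrib distrib_right left_diff_distrib mult.assoc)
  then have "(\<Sum>j\<in>UNIV. d j * (F (p j) * G (p j)) * p j ^ k) = 0" for k
    by (simp only: F(2) scaleR_zero_right) simp
  moreover have "F x * G x = 0 \<longleftrightarrow> (\<exists>l\<in>insert q L. same_sphere x l)" for x
    using F(1)[of x] sphere_polynomial_eq_0_iff[of x q] by (auto simp: G_def)
  ultimately show ?case
    by (intro exI[of _ "\<lambda>x. F x * G x"]) blast
qed

text \<open>After annihilation of all spheres other than that of \<open>p i\<close>, at most two terms of the relation remain,
  and the equations for \<open>k = 0\<close> and \<open>k = 1\<close> separate two distinct points.\<close>

lemma node_seq_eq_0_imp: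
  fixes p :: "'n::finite \<Rightarrow> quat"
  assumes inj: "inj p"
    and three: "\<And>i j k. i \<noteq> j \<Longrightarrow> i \<noteq> k \<Longrightarrow> j \<noteq> k \<Longrightarrow> \<not> (same_sphere (p j) (p i) \<and> same_sphere (p k) (p i))"
    and zero: "node_seq p (\<lambda>_. 1) c = (\<lambda>_. 0)"
  shows "c = 0"
proof -
  define d where "d j = qcnj (c $ j)" for j
  have "(\<Sum>j\<in>UNIV. d j * p j ^ k) = qcnj (node_seq p (\<lambda>_. 1) c k)" for k
    by (simp add: node_seq_def qcnj_sum d_def)
  then have d0: "(\<Sum>j\<in>UNIV. d j * p j ^ k) = 0" for k
    by (simp add: zero)
  have "d i = 0" for i
  proof -
    define L where "L = {x \<in> range p. \<not> same_sphere x (p i)}"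
    obtain F where F: "\<And>x. F x = 0 \<longleftrightarrow> (\<exists>l\<in>L. same_sphere x l)"
        "\<And>k. (\<Sum>j\<in>UNIV. d j * F (p j) * p j ^ k) = 0"
      using spheres_annihilated[of L d p] d0 by (auto simp: L_def)
    have Fi: "F (p i) \<noteq> 0"
      unfolding F(1) by (auto simp: L_def same_sphere_def)
    have Fj: "F (p j) = 0" if "\<not> same_sphere (p j) (p i)" for j
      unfolding F(1) using that by (auto simp: L_def same_sphere_def)
    show ?thesis
    proof (cases "\<exists>j. j \<noteq> i \<and> same_sphere (p j) (p i)")
      case True
      then obtain j where j: "j \<noteq> i" "same_sphere (p j) (p i)"
        by blast
      have others: "F (p l) = 0" if "l \<noteq> i" "l \<noteq> j" for l
        using three[of i j l] that j Fj by metis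
      have two: "d i * F (p i) * p i ^ k + d j * F (p j) * p j ^ k = 0" for k
      proof -
        have "(\<Sum>l\<in>UNIV. d l * F (p l) * p l ^ k) = (\<Sum>l\<in>{i, j}. d l * F (p l) * p l ^ k)"
          by (rule sum.mono_neutral_right) (use others in auto)
        then show ?thesis
          using F(2)[of k] j by simp
      qed
      have "d j * F (p j) = - (d i * F (p i))"
        using two[of 0] by (simp add: eq_neg_iff_add_eq_0 add.commute)
      then have "d i * F (p i) * (p i - p j) = 0"
        using two[of 1] by (simp add: right_diff_distrib)
      moreover have "p i \<noteq> p j"
        using inj j by (auto dest: injD)
      ultimately show ?thesis
        using Fi by simp
    next
      case False
      have "(\<Sum>l\<in>UNIV. d l * F (p l) * p l ^ 0) = (\<Sum>l\<in>{i}. d l * F (p l) * p l ^ 0)"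
        by (rule sum.mono_neutral_right) (use False Fj in auto)
      then show ?thesis
        using F(2)[of 0] Fi by simp
    qed
  qed
  then show ?thesis
    by (simp add: d_def vec_eq_iff)
qed

section \<open>Construction of an interpolant from a positive semidefinite Pick matrix\<close>

text \<open>Cholesky factorization by induction on the index set. The Schur complement of a diagonal entry \<open>r\<close> is
  again positive semidefinite and differs from \<open>P\<close> by a matrix of rank one. If \<open>r = 0\<close>, then its whole
  row vanishes, and the same formulas remain correct because \<open>inverse 0 = 0\<close>.\<close>

lemma gram_factorization_on:
  fixes P :: "'n \<Rightarrow> 'n \<Rightarrow> quat"
  assumes "finite A" "\<And>i j. i \<in> A \<Longrightarrow> j \<in> A \<Longrightarrow> P i j = qcnj (P j i)"
    and "\<And>c. 0 \<le> qre (\<Sum>i\<in>A. \<Sum>j\<in>A. qcnj (c i) * P i j * c j)"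
  shows "\<exists>X. \<forall>i\<in>A. \<forall>j\<in>A. P i j = (\<Sum>l\<in>A. X i l * qcnj (X j l))"
  using assms
proof (induction A arbitrary: P rule: finite_induct)
  case (insert a A)
  note herm = insert.prems(1) and psd = insert.prems(2)
  define F where "F P B c = (\<Sum>i\<in>B. \<Sum>j\<in>B. qcnj (c i) * P i j * c j)"
    for P :: "'n \<Rightarrow> 'n \<Rightarrow> quat" and B and c :: "'n \<Rightarrow> quat"
  define r where "r = qre (P a a)"
  have "qi (P a a) = 0" "qj (P a a) = 0" "qk (P a a) = 0"
    using arg_cong[OF herm[of a a], of qi] arg_cong[OF herm[of a a], of qj] arg_cong[OF herm[of a a], of qk]
    by simp_all
  then have Paa: "P a a = r *\<^sub>R 1"
    by (simp add: quat_eq_iff r_def)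
  have expand: "F P (insert a A) c = F P A c + qcnj (\<Sum>j\<in>A. P a j * c j) * c a
      + qcnj (c a) * (\<Sum>j\<in>A. P a j * c j) + r *\<^sub>R (qcnj (c a) * c a)" for c
  proof -
    have "qcnj (\<Sum>j\<in>A. P a j * c j) = (\<Sum>i\<in>A. qcnj (c i) * P i a)"
      unfolding qcnj_sum by (intro sum.cong refl) (metis herm insertCI qcnj_simps(1,5))
    then show ?thesis
      using insert.hyps
      by (simp add: F_def sum.distrib Paa sum_distrib_left sum_distrib_right mult.assoc del: times_quat.sel)
  qed
  have r0: "r \<ge> 0"
  proof -
    have "F P (insert a A) (\<lambda>i. if i = a then 1 else 0) = r *\<^sub>R 1"
    proof -
      have "F P A (\<lambda>i. if i = a then 1 else 0) = 0"
        unfolding F_def using insert.hyps by (intro sum.neutral ballI) auto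
      moreover have "(\<Sum>j\<in>A. P a j * (if j = a then 1 else 0)) = 0"
        using insert.hyps by (intro sum.neutral) auto
      ultimately show ?thesis
        by (simp add: expand)
    qed
    then show ?thesis
      using psd[of "\<lambda>i. if i = a then 1 else 0"] by (simp add: F_def)
  qed
  have null: "P a i = 0" if "r = 0" "i \<in> A" for i
  proof -
    define x where "x = qre (P i i)"
    \<comment> \<open>With this \<open>t\<close> the form takes the value \<open>-1\<close> at \<open>c\<close> if \<open>P a i \<noteq> 0\<close>.\<close>
    define t where "t = (x + 1) / (2 * (norm (P a i))\<^sup>2)"
    define c where "c j = (if j = i then 1 else if j = a then - (t *\<^sub>R P a i) else 0)" for j
    have ia: "i \<noteq> a"
      using that insert.hyps by auto
    have d: "(\<Sum>j\<in>A. f j * c j) = f i" for f :: "'n \<Rightarrow> quat"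
    proof -
      have "(\<Sum>j\<in>A. f j * c j) = (\<Sum>j\<in>{i}. f j * c j)"
        using insert.hyps that by (intro sum.mono_neutral_right) (auto simp: c_def)
      then show ?thesis
        by (simp add: c_def)
    qed
    have "F P A c = (\<Sum>k\<in>A. qcnj (c k) * P k i)"
      unfolding F_def d ..
    also have "\<dots> = (\<Sum>k\<in>{i}. qcnj (c k) * P k i)"
      using insert.hyps that by (intro sum.mono_neutral_right) (auto simp: c_def)
    finally have FA: "F P A c = P i i"
      by (simp add: c_def)
    have "F P (insert a A) c = P i i - (2 * t) *\<^sub>R (qcnj (P a i) * P a i)"
      unfolding expand d FA using that ia by (simp add: c_def quat_eq_iff algebra_simps)
    then have "qre (F P (insert a A) c) = x - 2 * t * (norm (P a i))\<^sup>2"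
      unfolding mult_qcnj_self by (simp add: x_def del: of_real_power)
    then have "0 \<le> x - 2 * t * (norm (P a i))\<^sup>2"
      using psd[of c] by (simp add: F_def)
    moreover have "2 * t * (norm (P a i))\<^sup>2 = x + 1" if "P a i \<noteq> 0"
      using that by (simp add: t_def)
    ultimately show ?thesis
      by force
  qed
  define Q where "Q i j = P i j - (P i a * P a j) /\<^sub>R r" for i j
  have "\<exists>X. \<forall>i\<in>A. \<forall>j\<in>A. Q i j = (\<Sum>l\<in>A. X i l * qcnj (X j l))"
  proof (rule insert.IH)
    show "Q i j = qcnj (Q j i)" if "i \<in> A" "j \<in> A" for i j
      using herm[of i j] herm[of i a] herm[of a j] that by (simp add: Q_def)
    show "0 \<le> qre (\<Sum>i\<in>A. \<Sum>j\<in>A. qcnj (c i) * Q i j * c j)" for c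
    proof -
      define b where "b = (\<Sum>j\<in>A. P a j * c j)"
      \<comment> \<open>The value at \<open>a\<close> minimizes the form, and the minimum is the form of the Schur complement.\<close>
      define c' where "c' = c(a := - (b /\<^sub>R r))"
      have c': "c' j = c j" if "j \<in> A" for j
        using that insert.hyps by (auto simp: c'_def)
      have b': "(\<Sum>j\<in>A. P a j * c' j) = b"
        unfolding b_def by (intro sum.cong refl) (simp add: c')
      have FA: "F P A c' = F P A c"
        unfolding F_def by (intro sum.cong refl) (simp add: c')
      have bb: "qcnj b = (\<Sum>i\<in>A. qcnj (c i) * P i a)"
        unfolding b_def qcnj_sum by (intro sum.cong refl) (metis herm insertCI qcnj_simps(1,5))
      have "(\<Sum>i\<in>A. \<Sum>j\<in>A. qcnj (c i) * Q i j * c j) = F P A c - (qcnj b * b) /\<^sub>R r"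
        unfolding Q_def F_def bb unfolding b_def sum_product scaleR_sum_right sum_subtractf[symmetric]
        by (intro sum.cong refl) (simp add: right_diff_distrib left_diff_distrib mult.assoc)
      also have "\<dots> = F P (insert a A) c'"
      proof -
        have "inverse r * inverse r * r = inverse r"
          by (cases "r = 0") simp_all
        then show ?thesis
          unfolding expand b' FA by (simp add: c'_def mult.commute[of r] mult.assoc del: times_quat.sel)
      qed
      finally show ?thesis
        using psd[of c'] by (simp add: F_def)
    qed
  qed
  then obtain X where X: "\<And>i j. i \<in> A \<Longrightarrow> j \<in> A \<Longrightarrow> Q i j = (\<Sum>l\<in>A. X i l * qcnj (X j l))"
    by blast
  define Y where "Y i l = (if l = a then P i a /\<^sub>R sqrt r else if i = a then 0 else X i l)" for i l
  have YA: "(\<Sum>l\<in>A. Y i l * qcnj (Y j l)) = (if i = a \<or> j = a then 0 else (\<Sum>l\<in>A. X i l * qcnj (X j l)))" for i j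
    using insert.hyps by (auto simp: Y_def intro!: sum.neutral sum.cong)
  have rr: "inverse (sqrt r) * inverse (sqrt r) = inverse r"
    using r0 by (simp flip: inverse_mult_distrib)
  have "P i j = (\<Sum>l\<in>insert a A. Y i l * qcnj (Y j l))" if "i \<in> insert a A" "j \<in> insert a A" for i j
  proof -
    have "(\<Sum>l\<in>insert a A. Y i l * qcnj (Y j l)) = (P i a * P a j) /\<^sub>R r + (\<Sum>l\<in>A. Y i l * qcnj (Y j l))"
      using insert.hyps herm[of a j] that rr by (simp add: Y_def)
    also have "\<dots> = P i j"
    proof (cases "i = a \<or> j = a")
      case True
      have "r = 0 \<longrightarrow> P i j = 0"
        using True null herm[of i j] that Paa by (auto simp: null)
      then show ?thesis
        using True by (auto simp: YA Paa)
    next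
      case False
      then show ?thesis
        using that by (simp add: YA X[symmetric] Q_def)
    qed
    finally show ?thesis ..
  qed
  then show ?case
    by blast
qed simp

lemma gram_factorization:
  fixes A :: "quat ^ 'n ^ 'n"
  assumes "psd_quat_matrix A"
  obtains X :: "'n \<Rightarrow> 'n \<Rightarrow> quat" where "\<And>i j. A $ i $ j = (\<Sum>l\<in>UNIV. X i l * qcnj (X j l))"
proof -
  have "\<exists>X. \<forall>i\<in>UNIV. \<forall>j\<in>UNIV. A $ i $ j = (\<Sum>l\<in>(UNIV :: 'n set). X i l * qcnj (X j l))"
  proof (rule gram_factorization_on)
    show "A $ i $ j = qcnj (A $ j $ i)" for i j
      using assms unfolding psd_quat_matrix_def by blast
    show "0 \<le> qre (\<Sum>i\<in>UNIV. \<Sum>j\<in>UNIV. qcnj (c i) * A $ i $ j * c j)" for c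
    proof -
      have "hermitian_form A (\<chi> i. c i) \<in> \<real>\<^sub>\<ge>\<^sub>0"
        using assms unfolding psd_quat_matrix_def hermitian_form_def by blast
      then show ?thesis
        unfolding hermitian_form_alt by (auto elim!: nonneg_Reals_cases)
    qed
  qed simp
  then show thesis
    using that by blast
qed

lemma vector_smult_simps:
  fixes x y :: "quat ^ 'm"
  shows "q *s (x + y) = q *s x + q *s y" "(q + q') *s x = q *s x + q' *s x"
    "q *s (x - y) = q *s x - q *s y" "(q - q') *s x = q *s x - q' *s x"
    "q *s (q' *s x) = (q * q') *s x" "of_real r *s x = r *\<^sub>R x" "q *s (r *\<^sub>R x) = r *\<^sub>R (q *s x)"
    "0 *s x = 0" "q *s 0 = 0" "1 *s x = x"
  by (simp_all add: vec_eq_iff distrib_left distrib_right left_diff_distrib right_diff_distrib mult.assoc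
      of_real_def del: times_quat.sel)

lemma vector_smult_sum: "q *s (\<Sum>i\<in>A. f i) = (\<Sum>i\<in>A. q *s (f i :: quat ^ 'm))"
  by (induction A rule: infinite_finite_induct) (simp_all add: vector_smult_simps)

lemma inner_smult: "inner (q *s x) y = inner x (qcnj q *s (y :: quat ^ 'm::finite))"
  by (simp add: inner_vec_def inner_mult_qcnj)

lemma norm_smult: "norm (q *s (x :: quat ^ 'm::finite)) = norm q * norm x"
  by (simp add: norm_vec_def L2_set_right_distrib norm_mult)

lemma bounded_linear_smult: "bounded_linear (\<lambda>x :: quat ^ 'm::finite. q *s x)"
  by (rule bounded_linear_intro[where K = "norm q"]) (simp_all add: vector_smult_simps norm_smult mult.commute)

text \<open>The linear map with \<open>w i \<mapsto> w' i\<close> is a well defined isometry on the span of the \<open>w i\<close>. Composing it with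
  the orthogonal projection onto this span gives \<open>U\<close>. The projection of the real Euclidean space is
  left linear over the quaternions, since left multiplication by \<open>q\<close> has left multiplication by the
  conjugate of \<open>q\<close> as its adjoint.\<close>

lemma contractive_extension:
  fixes w w' :: "'n::finite \<Rightarrow> quat ^ 'm::finite"
  assumes iso: "\<And>d. norm (\<Sum>i\<in>UNIV. d i *s w i) = norm (\<Sum>i\<in>UNIV. d i *s w' i)"
  obtains U where "\<And>x y. U (x + y) = U x + U y" "\<And>q x. U (q *s x) = q *s U x"
    "\<And>x. norm (U x) \<le> norm x" "\<And>i. U (w i) = w' i"
proof -
  define W where "W w d = (\<Sum>i\<in>UNIV. d i *s w i)" for w :: "'n \<Rightarrow> quat ^ 'm" and d
  have W_add: "W w (\<lambda>i. d i + e i) = W w d + W w e"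
    and W_diff: "W w (\<lambda>i. d i - e i) = W w d - W w e"
    and W_smult: "W w (\<lambda>i. q * d i) = q *s W w d" for w d e q
    by (simp_all add: W_def vector_smult_simps vector_smult_sum sum.distrib sum_subtractf)
  have W_unit: "W w (\<lambda>j. if j = i then 1 else 0) = w i" for w i
  proof -
    have "W w (\<lambda>j. if j = i then 1 else 0) = (\<Sum>j\<in>{i}. (if j = i then 1 else 0) *s w j)"
      unfolding W_def by (rule sum.mono_neutral_right) (auto simp: vector_smult_simps)
    then show ?thesis
      by (simp add: vector_smult_simps)
  qed
  have norm_W: "norm (W w d) = norm (W w' d)" for d
    unfolding W_def by (rule iso)
  define orth where "orth x d \<longleftrightarrow> (\<forall>e. inner (x - W w d) (W w e) = 0)" for x d
  have "\<exists>d. orth x d" for x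
  proof -
    have sub: "subspace (range (W w))"
      unfolding subspace_def
    proof (intro conjI ballI allI)
      show "0 \<in> range (W w)"
        by (rule range_eqI[of _ _ "\<lambda>_. 0"]) (simp add: W_def vector_smult_simps)
      fix x assume "x \<in> range (W w)"
      then obtain d where x: "x = W w d" ..
      show "x + y \<in> range (W w)" if y: "y \<in> range (W w)" for y
        using y unfolding x by (auto simp flip: W_add)
      show "r *\<^sub>R x \<in> range (W w)" for r
        unfolding x vector_smult_simps(6)[symmetric] W_smult[symmetric] by blast
    qed
    obtain y z where yz: "y \<in> span (range (W w))" "\<And>v. v \<in> span (range (W w)) \<Longrightarrow> orthogonal z v" "x = y + z"
      using orthogonal_subspace_decomp_exists[of "range (W w)" x] by blast
    have sp: "span (range (W w)) = range (W w)"
      using sub by (simp add: span_eq_iff)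
    obtain d where "y = W w d"
      using yz(1) unfolding sp by blast
    then have "orth x d"
      using yz(2,3) unfolding sp orth_def orthogonal_def by auto
    then show ?thesis
      by blast
  qed
  then obtain D where D: "\<And>x. orth x (D x)"
    by metis
  define U where "U x = W w' (D x)" for x
  have U: "U x = W w' d" if "orth x d" for x d
  proof -
    define e where "e = (\<lambda>i. D x i - d i)"
    have "inner (W w e) (W w e) = inner (x - W w d) (W w e) - inner (x - W w (D x)) (W w e)"
      unfolding inner_diff_left[symmetric] by (simp add: e_def W_diff)
    also have "\<dots> = 0"
      using that D[of x] by (simp add: orth_def)
    finally have "norm (W w' e) = 0"
      using norm_W[of e] by simp
    then show ?thesis
      by (simp add: U_def e_def W_diff)
  qed
  show thesis
  proof
    fix x y q
    have "orth (x + y) (\<lambda>i. D x i + D y i)"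
      using D[of x] D[of y] unfolding orth_def W_add by (simp add: inner_diff_left inner_add_left)
    from U[OF this] show "U (x + y) = U x + U y"
      by (simp only: W_add U_def[symmetric])
    have "inner (q *s x - q *s W w (D x)) (W w e) = inner (x - W w (D x)) (W w (\<lambda>i. qcnj q * e i))" for e
      by (simp only: vector_smult_simps(3)[symmetric] inner_smult W_smult)
    then have "inner (q *s x - q *s W w (D x)) (W w e) = 0" for e
      using D[of x] by (simp add: orth_def)
    then have "orth (q *s x) (\<lambda>i. q * D x i)"
      unfolding orth_def W_smult by blast
    from U[OF this] show "U (q *s x) = q *s U x"
      by (simp only: W_smult U_def[symmetric])
    have "orthogonal (W w (D x)) (x - W w (D x))"
      using D[of x] by (simp add: orth_def orthogonal_def inner_commute)
    then have "(norm x)\<^sup>2 = (norm (W w (D x)))\<^sup>2 + (norm (x - W w (D x)))\<^sup>2"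
      using norm_add_Pythagorean by fastforce
    then have "(norm (W w (D x)))\<^sup>2 \<le> (norm x)\<^sup>2"
      by simp
    then show "norm (U x) \<le> norm x"
      unfolding U_def norm_W[symmetric] by (rule power2_le_imp_le) simp
  next
    fix i
    have "orth (w i) (\<lambda>j. if j = i then 1 else 0)"
      by (simp add: orth_def W_unit)
    then show "U (w i) = w' i"
      by (simp add: U W_unit)
  qed
qed

lemma norm_sq_smult_sum:
  fixes w :: "'n::finite \<Rightarrow> quat ^ 'm::finite"
  shows "of_real ((norm (\<Sum>i\<in>UNIV. d i *s w i))\<^sup>2)
    = (\<Sum>i\<in>UNIV. \<Sum>j\<in>UNIV. d i * (\<Sum>k\<in>UNIV. w i $ k * qcnj (w j $ k)) * qcnj (d j))"
proof -
  have "of_real ((norm (\<Sum>i\<in>UNIV. d i *s w i))\<^sup>2) = (\<Sum>k\<in>UNIV. (of_real ((norm (\<Sum>i\<in>UNIV. d i * w i $ k))\<^sup>2) :: quat))"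
    unfolding power2_norm_eq_inner inner_vec_def by simp
  also have "\<dots> = (\<Sum>k\<in>UNIV. \<Sum>i\<in>UNIV. \<Sum>j\<in>UNIV. d i * (w i $ k * qcnj (w j $ k)) * qcnj (d j))"
    unfolding mult_qcnj_self(1)[symmetric] qcnj_sum sum_product by (simp add: mult.assoc)
  also have "\<dots> = (\<Sum>i\<in>UNIV. \<Sum>j\<in>UNIV. \<Sum>k\<in>UNIV. d i * (w i $ k * qcnj (w j $ k)) * qcnj (d j))"
    by (subst sum.swap, rule sum.cong[OF refl], rule sum.swap)
  finally show ?thesis
    by (simp add: sum_distrib_left sum_distrib_right)
qed

lemma sum_UNIV_option:
  fixes f :: "'n::finite option \<Rightarrow> 'a::comm_monoid_add"
  shows "(\<Sum>k\<in>UNIV. f k) = f None + (\<Sum>l\<in>UNIV. f (Some l))"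
  by (simp add: UNIV_option_conv sum.reindex)

text \<open>Shifting the index of the defining series by one.\<close>

lemma pick_matrix_stein:
  assumes "\<And>i. norm (p i) < 1"
  shows "pick_matrix p s $ i $ j + s i * qcnj (s j) = 1 + p i * pick_matrix p s $ i $ j * qcnj (p j)"
proof -
  define m where "m = 1 - s i * qcnj (s j)"
  have sm: "summable (\<lambda>k. p i ^ k * m * qcnj (p j) ^ k)"
    by (intro summable_kernel assms)
  have "(\<Sum>k. p i ^ k * m * qcnj (p j) ^ k) = m + (\<Sum>k. p i * (p i ^ k * m * qcnj (p j) ^ k) * qcnj (p j))"
    using suminf_split_head[OF sm] by (simp add: mult.assoc power_commutes)
  also have "(\<Sum>k. p i * (p i ^ k * m * qcnj (p j) ^ k) * qcnj (p j))
      = p i * (\<Sum>k. p i ^ k * m * qcnj (p j) ^ k) * qcnj (p j)"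
    using sm by (simp add: suminf_mult suminf_mult2[symmetric] summable_mult summable_mult2)
  finally have "(\<Sum>k. p i ^ k * m * qcnj (p j) ^ k) + s i * qcnj (s j)
      = m + p i * (\<Sum>k. p i ^ k * m * qcnj (p j) ^ k) * qcnj (p j) + s i * qcnj (s j)"
    by (rule arg_cong[where f = "\<lambda>x. x + s i * qcnj (s j)"])
  also have "\<dots> = 1 + p i * (\<Sum>k. p i ^ k * m * qcnj (p j) ^ k) * qcnj (p j)"
    by (simp add: m_def)
  finally show ?thesis
    by (simp add: pick_matrix_def m_def)
qed

text \<open>The coordinate \<open>None\<close> carries inputs and outputs, the other coordinates carry the state. Starting from
  the input \<open>e\<close> and feeding only the state back into \<open>U\<close>, one reads off the coefficients \<open>a k\<close> as
  outputs. The generating functions \<open>Y\<close> of the states and \<open>S\<close> of the outputs satisfy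
  \<open>U (e + q Y) = Y + S e\<close>. Taking norms gives \<open>\<bar>Y\<bar>\<^sup>2 + \<bar>S\<bar>\<^sup>2 \<le> 1 + \<bar>q\<bar>\<^sup>2 \<bar>Y\<bar>\<^sup>2\<close>, hence \<open>\<bar>S\<bar> \<le> 1\<close>. At a node,
  comparison with the equation for \<open>x i\<close> gives a contraction with factor \<open>\<bar>p i\<bar> < 1\<close>, whose only fixed
  point is zero; this forces \<open>S = s i\<close>.\<close>

lemma contractive_realization:
  fixes U :: "quat ^ 'n option \<Rightarrow> quat ^ ('n::finite) option" and x :: "'n \<Rightarrow> quat ^ 'n option"
  defines "e \<equiv> axis None 1"
  assumes U_add: "\<And>x y. U (x + y) = U x + U y" and U_smult: "\<And>q x. U (q *s x) = q *s U x"
    and U_norm: "\<And>x. norm (U x) \<le> norm x"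
    and x0: "\<And>i. x i $ None = 0" and U_x: "\<And>i. U (e + p i *s x i) = x i + s i *s e"
    and p: "\<And>i. norm (p i) < 1"
  obtains a where "\<And>k. norm (a k) \<le> 1" "\<And>p. norm p < 1 \<Longrightarrow> norm (\<Sum>k. p ^ k * a k) \<le> 1"
    "\<And>i. (\<Sum>k. p i ^ k * a k) = s i"
proof -
  define proj where "proj v = v - v $ None *s e" for v :: "quat ^ 'n option"
  define v where "v = rec_nat (U e) (\<lambda>_ v. U (proj v))"
  define a y where "a k = v k $ None" and "y k = proj (v k)" for k
  have v_simps: "v 0 = U e" "v (Suc k) = U (y k)" for k
    by (simp_all add: v_def y_def)
  have v_split: "v k = y k + a k *s e" for k
    by (simp add: y_def a_def proj_def)
  have y0: "y k $ None = 0" for k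
    by (simp add: y_def proj_def e_def axis_def)
  have pyth: "(norm (u + q *s e))\<^sup>2 = (norm u)\<^sup>2 + (norm q)\<^sup>2" if "u $ None = 0" for u q
  proof -
    have "(norm u)\<^sup>2 = (\<Sum>k\<in>UNIV. (norm (u $ k))\<^sup>2)" for u :: "quat ^ 'n option"
      by (simp add: power2_norm_eq_inner inner_vec_def)
    then show ?thesis
      using that by (simp add: sum_UNIV_option e_def axis_def)
  qed
  have ne: "norm e = 1"
    using pyth[of 0 1] power2_eq_iff_nonneg[of "norm e" 1] by (simp add: vector_smult_simps)
  interpret U: bounded_linear U
  proof (rule bounded_linear_intro[where K = 1])
    show "U (r *\<^sub>R x) = r *\<^sub>R U x" for r x
      using U_smult[of "of_real r" x] by (simp add: vector_smult_simps)
  qed (simp_all add: U_add U_norm)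
  have norm_y: "norm (y k) \<le> norm (v k)" for k
  proof -
    have "(norm (y k))\<^sup>2 \<le> (norm (v k))\<^sup>2"
      unfolding v_split[of k] pyth[OF y0] by simp
    then show ?thesis
      by (rule power2_le_imp_le) simp
  qed
  have norm_v: "norm (v k) \<le> 1" for k
  proof (induction k)
    case 0
    then show ?case
      using U_norm[of e] by (simp add: v_simps ne)
  next
    case (Suc k)
    then show ?case
      using U_norm[of "y k"] norm_y[of k] by (simp add: v_simps)
  qed
  have a_bd: "norm (a k) \<le> 1" for k
    unfolding a_def by (rule order_trans[OF Finite_Cartesian_Product.norm_nth_le norm_v])
  define Y S where "Y q = (\<Sum>k. q ^ k *s y k)" and "S q = (\<Sum>k. q ^ k * a k)" for q
  have smult_summable: "summable (\<lambda>k. q ^ k *s u k)" if q: "norm q < 1" and u: "\<And>k. norm (u k) \<le> 1"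
    for q and u :: "nat \<Rightarrow> quat ^ 'n option"
  proof (rule summable_comparison_test'[of "\<lambda>k. norm q ^ k"])
    show "summable (\<lambda>k. norm q ^ k)"
      using q by (simp add: summable_geometric)
    show "norm (q ^ k *s u k) \<le> norm q ^ k" if "k \<ge> 0" for k
      unfolding norm_smult norm_power using u by (intro mult_left_le) simp_all
  qed
  have y_bd: "norm (y k) \<le> 1" for k
    by (rule order_trans[OF norm_y norm_v])
  have Y0: "Y q $ None = 0" if "norm q < 1" for q
  proof -
    have "(\<lambda>k. (q ^ k *s y k) $ None) sums Y q $ None"
      unfolding Y_def
      by (intro bounded_linear.sums[OF bounded_linear_vec_nth] summable_sums smult_summable that y_bd)
    then show ?thesis
      by (simp add: y0 sums_iff)
  qed
  have realize: "U (e + q *s Y q) = Y q + S q *s e" if q: "norm q < 1" for q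
  proof -
    have sy: "(\<lambda>k. q ^ k *s y k) sums Y q"
      unfolding Y_def by (intro summable_sums smult_summable q y_bd)
    have "(\<lambda>k. q ^ k * a k) sums S q"
      unfolding S_def using summable_power_series(2)[of a 1 q] a_bd q by (simp add: summable_sums)
    then have "(\<lambda>k. (q ^ k * a k) *s e) sums (S q *s e)"
      by (rule bounded_linear.sums[rotated])
         (rule bounded_linear_intro[where K = "norm e"], simp_all add: vector_smult_simps norm_smult vec_eq_iff)
    then have V: "(\<lambda>k. q ^ k *s v k) sums (Y q + S q *s e)"
      using sums_add[OF sy] by (simp add: v_split vector_smult_simps)
    have "(\<lambda>k. U (q *s (q ^ k *s y k))) sums U (q *s Y q)"
      by (intro U.sums bounded_linear.sums[OF bounded_linear_smult] sy)
    then have "(\<lambda>k. q ^ Suc k *s v (Suc k)) sums U (q *s Y q)"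
      by (simp add: U_smult v_simps vector_smult_simps)
    then have "(\<lambda>k. q ^ k *s v k) sums (U (q *s Y q) + q ^ 0 *s v 0)"
      by (rule sums_Suc)
    then have "(\<lambda>k. q ^ k *s v k) sums U (e + q *s Y q)"
      by (simp add: v_simps U_add vector_smult_simps add.commute)
    then show ?thesis
      using V by (rule sums_unique2)
  qed
  show thesis
  proof
    show "norm (a k) \<le> 1" for k
      by (rule a_bd)
    show "norm (\<Sum>k. q ^ k * a k) \<le> 1" if q: "norm q < 1" for q
    proof -
      have "(norm (U (e + q *s Y q)))\<^sup>2 \<le> (norm (e + q *s Y q))\<^sup>2"
        using U_norm by (simp add: power_mono)
      also have "\<dots> = (norm q)\<^sup>2 * (norm (Y q))\<^sup>2 + 1"
        using pyth[of "q *s Y q" 1] Y0[OF q] by (simp add: norm_smult power_mult_distrib add.commute)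
      finally have "(norm (Y q))\<^sup>2 + (norm (S q))\<^sup>2 \<le> (norm q)\<^sup>2 * (norm (Y q))\<^sup>2 + 1"
        unfolding realize[OF q] by (simp add: pyth Y0[OF q])
      moreover have "(norm q)\<^sup>2 * (norm (Y q))\<^sup>2 \<le> 1 * (norm (Y q))\<^sup>2"
        using q by (intro mult_right_mono power_le_one) auto
      ultimately have "(norm (S q))\<^sup>2 \<le> 1"
        by simp
      then show ?thesis
        unfolding S_def by (simp add: power_le_one_iff abs_square_le_1)
    qed
    show "(\<Sum>k. p i ^ k * a k) = s i" for i
    proof -
      define z where "z = Y (p i) - x i"
      have "U (p i *s z) = U (e + p i *s Y (p i)) - U (e + p i *s x i)"
        unfolding U.diff[symmetric] by (simp add: z_def vector_smult_simps)
      also have "\<dots> = z + (S (p i) - s i) *s e"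
        unfolding realize[OF p] U_x by (simp add: z_def vector_smult_simps)
      finally have "(norm (z + (S (p i) - s i) *s e))\<^sup>2 \<le> (norm (p i *s z))\<^sup>2"
        using U_norm[of "p i *s z"] by (simp add: power_mono)
      moreover have "z $ None = 0"
        using Y0[OF p] x0 by (simp add: z_def)
      ultimately have *: "(norm z)\<^sup>2 + (norm (S (p i) - s i))\<^sup>2 \<le> (norm (p i))\<^sup>2 * (norm z)\<^sup>2"
        by (simp only: pyth norm_smult power_mult_distrib)
      have "(norm (p i))\<^sup>2 * (norm z)\<^sup>2 \<le> 1 * (norm z)\<^sup>2"
        using p[of i] by (intro mult_right_mono power_le_one) auto
      with * have "(norm (S (p i) - s i))\<^sup>2 \<le> 0"
        by linarith
      then show ?thesis
        by (simp add: S_def)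
    qed
  qed
qed

proposition psd_pick_matrix_imp_interpolant:
  fixes p s :: "'n::finite \<Rightarrow> quat"
  assumes p: "\<And>i. norm (p i) < 1" and psd: "psd_quat_matrix (pick_matrix p s)"
  obtains a where "\<And>k. norm (a k) \<le> 1" "\<And>p. norm p < 1 \<Longrightarrow> norm (\<Sum>k. p ^ k * a k) \<le> 1"
    "\<And>i. (\<Sum>k. p i ^ k * a k) = s i"
proof -
  obtain X :: "'n \<Rightarrow> 'n \<Rightarrow> quat" where X: "\<And>i j. pick_matrix p s $ i $ j = (\<Sum>l\<in>UNIV. X i l * qcnj (X j l))"
    using gram_factorization[OF psd] by blast
  define e :: "quat ^ 'n option" where "e = axis None 1"
  define x :: "'n \<Rightarrow> quat ^ 'n option" where "x i = (\<chi> k. case k of None \<Rightarrow> 0 | Some l \<Rightarrow> X i l)" for i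
  define w w' where "w i = e + p i *s x i" and "w' i = x i + s i *s e" for i
  have "(\<Sum>k\<in>UNIV. w i $ k * qcnj (w j $ k)) = (\<Sum>k\<in>UNIV. w' i $ k * qcnj (w' j $ k))" for i j
  proof -
    have "(\<Sum>k\<in>UNIV. w i $ k * qcnj (w j $ k)) = 1 + p i * pick_matrix p s $ i $ j * qcnj (p j)"
      by (simp add: sum_UNIV_option w_def e_def x_def axis_def X sum_distrib_left sum_distrib_right mult.assoc)
    also have "\<dots> = pick_matrix p s $ i $ j + s i * qcnj (s j)"
      using pick_matrix_stein[where p = p, OF p] by simp
    also have "\<dots> = (\<Sum>k\<in>UNIV. w' i $ k * qcnj (w' j $ k))"
      by (simp add: sum_UNIV_option w'_def e_def x_def axis_def X)
    finally show ?thesis .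
  qed
  then have "of_real ((norm (\<Sum>i\<in>UNIV. d i *s w i))\<^sup>2) = (of_real ((norm (\<Sum>i\<in>UNIV. d i *s w' i))\<^sup>2) :: quat)" for d
    unfolding norm_sq_smult_sum by simp
  then have "norm (\<Sum>i\<in>UNIV. d i *s w i) = norm (\<Sum>i\<in>UNIV. d i *s w' i)" for d
    by (simp only: of_real_eq_iff power2_eq_iff_nonneg norm_ge_zero)
  then obtain U where U: "\<And>x y. U (x + y) = U x + U y" "\<And>q x. U (q *s x) = q *s U x"
    "\<And>x. norm (U x) \<le> norm x" "\<And>i. U (w i) = w' i"
    using contractive_extension[of w w'] by blast
  show thesis
  proof (rule contractive_realization[of U x p s])
    show "U (axis None 1 + p i *s x i) = x i + s i *s axis None 1" for i
      using U(4)[of i] by (simp add: w_def w'_def e_def)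
    show "x i $ None = 0" for i
      by (simp add: x_def)
  qed (use U p that in blast)+
qed

section \<open>Definite and singular Pick matrices\<close>

text \<open>An injective map of a finite dimensional real space is onto, which gives a right inverse matrix.
  Injectivity makes it a left inverse as well.\<close>

lemma not_invertible_imp_kernel:
  fixes A :: "quat ^ 'n ^ 'n"
  assumes "\<not> invertible A"
  obtains c where "c \<noteq> 0" "A *v c = 0"
proof (rule ccontr)
  assume "\<not> thesis"
  then have ker: "A *v c = 0 \<Longrightarrow> c = 0" for c
    using that by blast
  have lin: "linear (\<lambda>c. A *v c)"
    by (rule linearI) (simp_all add: matrix_vector_mult_def vec_eq_iff distrib_left sum.distrib scaleR_sum_right
        del: times_quat.sel)
  then have "inj (\<lambda>c. A *v c)"
    using ker by (simp add: linear_injective_0)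
  then have "surj (\<lambda>c. A *v c)"
    using lin linear_inj_imp_surj by blast
  then have "\<exists>b. A *v b = axis j 1" for j
    by (metis surjD)
  then obtain b where b: "\<And>j. A *v b j = axis j 1"
    by metis
  define B where "B = (\<chi> i j. b j $ i)"
  have right: "A ** B = mat 1"
  proof -
    have "(A ** B) $ i $ j = mat 1 $ i $ j" for i j
    proof -
      have "(A ** B) $ i $ j = (A *v b j) $ i"
        by (simp add: matrix_matrix_mult_def matrix_vector_mult_def B_def)
      then show ?thesis
        by (simp add: b mat_def axis_def)
    qed
    then show ?thesis
      by (simp add: vec_eq_iff)
  qed
  have "B *v (A *v c) = c" for c
  proof -
    have "A *v (B *v (A *v c) - c) = (A ** B) *v (A *v c) - A *v c"
      by (simp add: matrix_vector_mult_diff_distrib matrix_vector_mul_assoc matrix_mul_assoc)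
    then have "A *v (B *v (A *v c) - c) = 0"
      by (simp add: right)
    from ker[OF this] show ?thesis
      by simp
  qed
  then have *: "(B ** A) *v c = c" for c
    by (simp add: matrix_vector_mul_assoc)
  have "(B ** A) $ i $ j = mat 1 $ i $ j" for i j
  proof -
    have "(B ** A) $ i $ j = (\<Sum>k\<in>{j}. (B ** A) $ i $ k * axis j 1 $ k)"
      by (simp add: axis_def)
    also have "\<dots> = ((B ** A) *v axis j 1) $ i"
      unfolding matrix_vector_mult_def vec_lambda_beta
      by (rule sum.mono_neutral_left) (auto simp: axis_def)
    also have "\<dots> = mat 1 $ i $ j"
      unfolding * by (simp add: axis_def mat_def)
    finally show ?thesis .
  qed
  then have "B ** A = mat 1"
    by (simp add: vec_eq_iff)
  with right assms show False
    by (auto simp: invertible_def)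
qed

text \<open>For \<open>A = X X\<^sup>*\<close> the form at \<open>c\<close> is \<open>\<parallel>X\<^sup>* c\<parallel>\<^sup>2\<close>.\<close>

lemma psd_hermitian_form_eq_0_imp:
  fixes A :: "quat ^ 'n ^ 'n"
  assumes "psd_quat_matrix A" "hermitian_form A c = 0"
  shows "A *v c = 0"
proof -
  obtain X :: "'n \<Rightarrow> 'n \<Rightarrow> quat" where X: "\<And>i j. A $ i $ j = (\<Sum>l\<in>UNIV. X i l * qcnj (X j l))"
    using gram_factorization[OF assms(1)] by blast
  define y where "y l = (\<Sum>j\<in>UNIV. qcnj (X j l) * c $ j)" for l
  have "hermitian_form A c = (\<Sum>i\<in>UNIV. \<Sum>j\<in>UNIV. \<Sum>l\<in>UNIV. (qcnj (c $ i) * X i l) * (qcnj (X j l) * c $ j))"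
    by (simp add: hermitian_form_alt X sum_distrib_left sum_distrib_right mult.assoc)
  also have "\<dots> = (\<Sum>l\<in>UNIV. \<Sum>i\<in>UNIV. \<Sum>j\<in>UNIV. (qcnj (c $ i) * X i l) * (qcnj (X j l) * c $ j))"
    by (rule sym, subst sum.swap, rule sum.cong[OF refl], rule sum.swap)
  also have "\<dots> = (\<Sum>l\<in>UNIV. qcnj (y l) * y l)"
    by (simp add: y_def qcnj_sum sum_product)
  also have "\<dots> = of_real (\<Sum>l\<in>UNIV. (norm (y l))\<^sup>2)"
    by (simp only: mult_qcnj_self of_real_sum)
  finally have "(\<Sum>l\<in>UNIV. (norm (y l))\<^sup>2) = 0"
    using assms(2) by (metis of_real_eq_0_iff)
  then have y0: "y l = 0" for l
    by (simp add: sum_nonneg_eq_0_iff)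
  have "(A *v c) $ i = (\<Sum>l\<in>UNIV. X i l * y l)" for i
    unfolding matrix_vector_mult_def vec_lambda_beta X y_def sum_distrib_left sum_distrib_right
    by (subst sum.swap) (simp add: mult.assoc)
  then show ?thesis
    by (simp add: vec_eq_iff y0)
qed

lemma psd_invertible_iff_definite:
  assumes "psd_quat_matrix A"
  shows "invertible A \<longleftrightarrow> (\<forall>c. c \<noteq> 0 \<longrightarrow> hermitian_form A c \<noteq> 0)"
proof
  assume "invertible A"
  then obtain B where B: "B ** A = mat 1"
    by (auto simp: invertible_def)
  have "c = 0" if "hermitian_form A c = 0" for c
  proof -
    have "c = (B ** A) *v c"
      by (simp add: B)
    also have "\<dots> = 0"
      using psd_hermitian_form_eq_0_imp[OF assms that] by (simp flip: matrix_vector_mul_assoc)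
    finally show ?thesis .
  qed
  then show "\<forall>c. c \<noteq> 0 \<longrightarrow> hermitian_form A c \<noteq> 0"
    by blast
next
  assume *: "\<forall>c. c \<noteq> 0 \<longrightarrow> hermitian_form A c \<noteq> 0"
  show "invertible A"
  proof (rule ccontr)
    assume "\<not> invertible A"
    then obtain c where "c \<noteq> 0" "A *v c = 0"
      by (rule not_invertible_imp_kernel)
    with * show False
      by (auto simp: hermitian_form_def)
  qed
qed

lemma continuous_on_node_norm:
  assumes "\<And>i. norm (p i) < 1"
  shows "continuous_on S (node_norm p w)"
proof -
  have "node_norm p w c = qre (\<Sum>i\<in>UNIV. \<Sum>j\<in>UNIV.
      qcnj (c $ i) * (\<Sum>k. p i ^ k * (w i * qcnj (w j)) * qcnj (p j) ^ k) * c $ j)" for c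
    unfolding of_real_node_norm[where p = p, OF assms, symmetric] by simp
  then show ?thesis
    by (auto intro!: continuous_intros bounded_linear.continuous_on[OF bounded_linear_qre]
        bounded_linear.continuous_on[OF bounded_linear_qcnj])
qed

lemma node_norm_scaleR:
  assumes "\<And>i. norm (p i) < 1"
  shows "node_norm p w (r *\<^sub>R c) = r\<^sup>2 * node_norm p w c"
    and "node_norm p (\<lambda>i. r *\<^sub>R w i) c = r\<^sup>2 * node_norm p w c"
proof -
  have "node_seq p w (r *\<^sub>R c) k = r *\<^sub>R node_seq p w c k"
    and "node_seq p (\<lambda>i. r *\<^sub>R w i) c k = r *\<^sub>R node_seq p w c k" for k
    by (simp_all add: node_seq_def scaleR_sum_right)
  then show "node_norm p w (r *\<^sub>R c) = r\<^sup>2 * node_norm p w c"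
    and "node_norm p (\<lambda>i. r *\<^sub>R w i) c = r\<^sup>2 * node_norm p w c"
    unfolding node_norm_def
    using suminf_mult[OF summable_node_seq_sq[where p = p, OF assms]] by (simp_all add: power_mult_distrib)
qed

lemma node_norm_nonneg: 
  assumes "\<And>i. norm (p i) < 1"
  shows "node_norm p w c \<ge> 0"
  unfolding node_norm_def by (intro suminf_nonneg summable_node_seq_sq assms) simp

text \<open>On the compact unit sphere a strict inequality between continuous functions leaves a gap \<open>m > 0\<close>;
  homogeneity extends the scaled inequality to all vectors.\<close>

lemma scaled_pick_matrix_psd:
  fixes p s :: "'n::finite \<Rightarrow> quat"
  assumes p: "\<And>i. norm (p i) < 1"
    and strict: "\<And>c. c \<noteq> 0 \<Longrightarrow> node_norm p s c < node_norm p (\<lambda>_. 1) c"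
  obtains t where "t > 1" "psd_quat_matrix (pick_matrix p (\<lambda>i. t *\<^sub>R s i))"
proof -
  define B :: "(quat ^ 'n) set" where "B = sphere 0 1"
  have B: "compact B" "B \<noteq> {}"
    by (simp_all add: B_def)
  have cont: "continuous_on B (\<lambda>c. node_norm p (\<lambda>_. 1) c - node_norm p s c)" "continuous_on B (node_norm p s)"
    by (intro continuous_on_diff continuous_on_node_norm p)+
  obtain c0 where c0: "c0 \<in> B" "\<And>c. c \<in> B \<Longrightarrow> node_norm p (\<lambda>_. 1) c0 - node_norm p s c0 \<le> node_norm p (\<lambda>_. 1) c - node_norm p s c"
    using continuous_attains_inf[OF B cont(1)] by blast
  obtain c1 where c1: "c1 \<in> B" "\<And>c. c \<in> B \<Longrightarrow> node_norm p s c \<le> node_norm p s c1"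
    using continuous_attains_sup[OF B cont(2)] by blast
  define m M where "m = node_norm p (\<lambda>_. 1) c0 - node_norm p s c0" and "M = node_norm p s c1"
  have "c0 \<noteq> 0"
    using c0(1) by (auto simp: B_def)
  then have m: "m > 0"
    using strict by (simp add: m_def)
  have M: "M \<ge> 0"
    unfolding M_def by (rule node_norm_nonneg[OF p])
  \<comment> \<open>The excess \<open>(t\<^sup>2 - 1) M\<close> stays below the gap \<open>m\<close>. The denominator \<open>M + 1\<close> covers the case \<open>M = 0\<close>.\<close>
  define t where "t = sqrt (1 + m / (M + 1))"
  have t2: "t\<^sup>2 = 1 + m / (M + 1)"
    using m M by (simp add: t_def)
  have on_sphere: "t\<^sup>2 * node_norm p s c \<le> node_norm p (\<lambda>_. 1) c" if c: "c \<in> B" for c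
  proof -
    have "t\<^sup>2 * node_norm p s c = node_norm p s c + m / (M + 1) * node_norm p s c"
      by (simp add: t2 algebra_simps)
    also have "m / (M + 1) * node_norm p s c \<le> m / (M + 1) * (M + 1)"
      using c1(2)[OF c] m M by (intro mult_left_mono) (auto simp: M_def)
    also have "m / (M + 1) * (M + 1) = m"
      using M by simp
    finally show ?thesis
      using c0(2)[OF c] by (simp add: m_def)
  qed
  show thesis
  proof
    show "t > 1"
      using m M by (simp add: t_def)
    have "t\<^sup>2 * node_norm p s c \<le> node_norm p (\<lambda>_. 1) c" for c
    proof (cases "c = 0")
      case True
      then show ?thesis
        using node_norm_scaleR(1)[where p = p and r = 0, OF p] by simp
    next
      case False
      define u where "u = c /\<^sub>R norm c"
      have "u \<in> B" and c: "c = norm c *\<^sub>R u"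
        using False by (simp_all add: u_def B_def)
      have "(norm c)\<^sup>2 * (t\<^sup>2 * node_norm p s u) \<le> (norm c)\<^sup>2 * node_norm p (\<lambda>_. 1) u"
        using on_sphere[OF \<open>u \<in> B\<close>] by (intro mult_left_mono) auto
      then show ?thesis
        by (subst (1 2) c) (simp add: node_norm_scaleR(1)[where p = p, OF p] algebra_simps)
    qed
    then show "psd_quat_matrix (pick_matrix p (\<lambda>i. t *\<^sub>R s i))"
      unfolding psd_pick_matrix_iff[where p = p, OF p] node_norm_scaleR(2)[where p = p, OF p] by blast
  qed
qed

text \<open>If \<open>Q\<close> vanishes on \<open>L\<close>, then so does \<open>x Q(x) - Q(x) c\<close>, which is again a polynomial with coefficients
  on the right. It also vanishes at \<open>q\<close> for \<open>c = Q(q)\<^sup>-\<^sup>1 q Q(q)\<close>.\<close>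

lemma annihilating_polynomial:
  assumes "finite (L :: quat set)"
  shows "\<exists>b N. b N = 1 \<and> (\<forall>k>N. b k = 0) \<and> (\<forall>q\<in>L. (\<Sum>k\<le>N. q ^ k * b k) = 0)"
  using assms
proof (induction L rule: finite_induct)
  case empty
  show ?case
    by (rule exI[of _ "\<lambda>k. if k = 0 then 1 else 0"], rule exI[of _ 0]) simp
next
  case (insert q L)
  then obtain b N where b: "b N = 1" "\<And>k. k > N \<Longrightarrow> b k = 0" "\<And>q. q \<in> L \<Longrightarrow> (\<Sum>k\<le>N. q ^ k * b k) = 0"
    by blast
  define v where "v x = (\<Sum>k\<le>N. x ^ k * b k)" for x
  define c where "c = inverse (v q) * q * v q"
  define b' where "b' k = (if k = 0 then 0 else b (k - 1)) - b k * c" for k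
  have eq: "(\<Sum>k\<le>Suc N. x ^ k * b' k) = x * v x - v x * c" for x
  proof -
    have "(\<Sum>k\<le>Suc N. x ^ k * b' k)
        = (\<Sum>k\<le>Suc N. x ^ k * (if k = 0 then 0 else b (k - 1))) - (\<Sum>k\<le>Suc N. x ^ k * b k * c)"
      by (simp only: b'_def right_diff_distrib sum_subtractf mult.assoc)
    also have "(\<Sum>k\<le>Suc N. x ^ k * (if k = 0 then 0 else b (k - 1))) = (\<Sum>k\<le>N. x * (x ^ k * b k))"
      by (subst sum.atMost_Suc_shift) (simp add: mult.assoc)
    also have "\<dots> = x * v x"
      by (simp add: v_def sum_distrib_left)
    also have "(\<Sum>k\<le>Suc N. x ^ k * b k * c) = v x * c"
      by (simp add: v_def sum_distrib_right b(2))
    finally show ?thesis .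
  qed
  have "q * v q - v q * c = 0"
    by (cases "v q = 0") (simp_all add: c_def mult.assoc[symmetric])
  then have "(\<Sum>k\<le>Suc N. x ^ k * b' k) = 0" if "x \<in> insert q L" for x
    using that b(3) unfolding eq by (auto simp: v_def)
  moreover have "b' (Suc N) = 1" "\<forall>k>Suc N. b' k = 0"
    using b by (simp_all add: b'_def)
  ultimately show ?case
    by blast
qed

text \<open>Undefined outside the ball, as the elements of the class of bounded slice regular functions are.\<close>

definition ball_function :: "(nat \<Rightarrow> quat) \<Rightarrow> quat \<Rightarrow> quat" where
  "ball_function a = restrict (\<lambda>p. \<Sum>k. p ^ k * a k) (ball 0 1)"

lemma ball_function_schur:
  assumes "\<And>k. norm (a k) \<le> C" "\<And>p. norm p < 1 \<Longrightarrow> norm (\<Sum>k. p ^ k * a k) \<le> 1"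
  shows "ball_function a \<in> slice_schur_class"
proof -
  have "slice_regular_on (ball_function a) (ball 0 1)"
    by (rule slice_regular_on_cong[OF slice_regular_power_series[of a C]])
       (use assms(1) in \<open>simp_all add: ball_function_def\<close>)
  moreover have "ball_function a \<in> ball 0 1 \<rightarrow>\<^sub>E cball 0 1"
    using assms(2) by (auto simp: ball_function_def)
  ultimately show ?thesis
    by (simp add: slice_schur_class_def)
qed

lemma schur_class_power_series:
  assumes "S \<in> slice_schur_class"
  obtains a where "\<And>p. norm p < 1 \<Longrightarrow> (\<lambda>k. p ^ k * a k) sums S p"
    "\<And>K g. (\<Sum>k<K. (norm (star_product a g k))\<^sup>2) \<le> (\<Sum>k<K. (norm (g k))\<^sup>2)"
proof -
  obtain a where a: "\<And>p. norm p < 1 \<Longrightarrow> (\<lambda>k. p ^ k * a k) sums S p"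
    using assms slice_regular_imp_power_series[of S] unfolding slice_schur_class_def by blast
  moreover have "norm (S p) \<le> 1" if "norm p < 1" for p
    using assms that by (auto simp: slice_schur_class_def PiE_def Pi_def)
  ultimately show thesis
    using that schur_star_product_contractive[of a S] by blast
qed

text \<open>The scaled problem gives a solution bounded by \<open>1 / t\<close>. Adding \<open>\<epsilon>\<close> times a polynomial that vanishes
  at the nodes keeps the bound one and changes the function.\<close>

lemma strict_pick_not_unique:
  fixes p s :: "'n::finite \<Rightarrow> quat"
  assumes p: "\<And>i. norm (p i) < 1"
    and strict: "\<And>c. c \<noteq> 0 \<Longrightarrow> node_norm p s c < node_norm p (\<lambda>_. 1) c"
  shows "\<exists>S\<in>slice_schur_class. \<exists>S'\<in>slice_schur_class. S \<noteq> S' \<and> (\<forall>i. S (p i) = s i) \<and> (\<forall>i. S' (p i) = s i)"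
proof -
  obtain t where t: "t > 1" "psd_quat_matrix (pick_matrix p (\<lambda>i. t *\<^sub>R s i))"
    using scaled_pick_matrix_psd[OF p strict] by blast
  obtain a where a: "\<And>k. norm (a k) \<le> 1" "\<And>p. norm p < 1 \<Longrightarrow> norm (\<Sum>k. p ^ k * a k) \<le> 1"
    "\<And>i. (\<Sum>k. p i ^ k * a k) = t *\<^sub>R s i"
    using psd_pick_matrix_imp_interpolant[OF p t(2)] by blast
  obtain b N where b: "b N = 1" "\<And>k. k > N \<Longrightarrow> b k = 0" "\<And>i. (\<Sum>k\<le>N. p i ^ k * b k) = 0"
    using annihilating_polynomial[of "range p"] by auto
  define \<beta> where "\<beta> = (\<Sum>k\<le>N. norm (b k))"
  have "norm (b N) \<le> \<beta>"
    unfolding \<beta>_def by (rule member_le_sum) auto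
  then have \<beta>: "\<beta> \<ge> 1"
    by (simp add: b)
  \<comment> \<open>The polynomial is at most \<open>\<beta>\<close> on the ball, so this multiple of it just fills the room left by \<open>1 / t\<close>.\<close>
  define \<epsilon> where "\<epsilon> = (1 - 1 / t) / \<beta>"
  have \<epsilon>: "\<epsilon> > 0" "1 / t + \<epsilon> * \<beta> = 1"
    using t(1) \<beta> by (simp_all add: \<epsilon>_def)
  have b_bd: "norm (b k) \<le> \<beta>" for k
  proof (cases "k \<le> N")
    case True
    then show ?thesis
      unfolding \<beta>_def by (intro member_le_sum) auto
  qed (use b(2) \<beta> in auto)
  have b_sums: "(\<lambda>k. q ^ k * b k) sums (\<Sum>k\<le>N. q ^ k * b k)" for q
    by (rule sums_finite) (auto simp: b(2))
  have b_le: "norm (\<Sum>k\<le>N. q ^ k * b k) \<le> \<beta>" if "norm q < 1" for q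
    unfolding \<beta>_def
  proof (rule sum_norm_le)
    show "norm (q ^ k * b k) \<le> norm (b k)" for k
      using that by (simp add: norm_mult norm_power mult_left_le_one_le power_le_one)
  qed
  define f where "f e k = (1 / t) *\<^sub>R a k + e *\<^sub>R b k" for e k
  have f_sums: "(\<lambda>k. q ^ k * f e k) sums ((1 / t) *\<^sub>R (\<Sum>k. q ^ k * a k) + e *\<^sub>R (\<Sum>k\<le>N. q ^ k * b k))"
    if "norm q < 1" for e q
  proof -
    have "(\<lambda>k. (1 / t) *\<^sub>R (q ^ k * a k) + e *\<^sub>R (q ^ k * b k))
        sums ((1 / t) *\<^sub>R (\<Sum>k. q ^ k * a k) + e *\<^sub>R (\<Sum>k\<le>N. q ^ k * b k))"
      using summable_power_series(2)[of a 1 q] a(1) that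
      by (intro sums_add sums_scaleR_right b_sums summable_sums) auto
    then show ?thesis
      by (simp add: f_def distrib_left)
  qed
  have schur: "ball_function (f e) \<in> slice_schur_class" if e: "0 \<le> e" "e \<le> \<epsilon>" for e
  proof (rule ball_function_schur)
    show "norm (f e k) \<le> 1 / t + e * \<beta>" for k
      unfolding f_def using a(1)[of k] b_bd[of k] e t(1)
      by (intro norm_triangle_mono) (simp_all add: divide_right_mono mult_left_mono)
    show "norm (\<Sum>k. q ^ k * f e k) \<le> 1" if q: "norm q < 1" for q
    proof -
      have "norm (\<Sum>k. q ^ k * f e k) \<le> 1 / t + e * \<beta>"
        unfolding sums_unique[OF f_sums[OF q], symmetric] using a(2)[OF q] b_le[OF q] e t(1)
        by (intro norm_triangle_mono) (simp_all add: divide_right_mono mult_left_mono)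
      also have "\<dots> \<le> 1 / t + \<epsilon> * \<beta>"
        using e \<beta> by (simp add: mult_right_mono)
      finally show ?thesis
        by (simp add: \<epsilon>)
    qed
  qed
  have interp: "ball_function (f e) (p i) = s i" for e i
    using sums_unique[OF f_sums[OF p[of i], of e]] p[of i] t(1) by (simp add: ball_function_def a(3) b(3))
  have "ball_function (f 0) \<noteq> ball_function (f \<epsilon>)"
  proof
    assume eq: "ball_function (f 0) = ball_function (f \<epsilon>)"
    have "f 0 = f \<epsilon>"
    proof (rule real_power_series_unique)
      fix x :: real assume x: "\<bar>x\<bar> < 1"
      have fx: "(\<lambda>k. x ^ k *\<^sub>R f e k) sums ball_function (f e) (of_real x)" for e
      proof -
        have "(\<lambda>k. of_real x ^ k * f e k) sums (\<Sum>k. of_real x ^ k * f e k)"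
          using sums_summable[OF f_sums[of "of_real x" e]] x by (simp add: summable_sums)
        then show ?thesis
          using x by (simp add: ball_function_def scaleR_conv_of_real)
      qed
      show "(\<lambda>k. x ^ k *\<^sub>R f 0 k) sums ball_function (f 0) (of_real x)"
        by (rule fx)
      show "(\<lambda>k. x ^ k *\<^sub>R f \<epsilon> k) sums ball_function (f 0) (of_real x)"
        unfolding eq by (rule fx)
    qed
    from fun_cong[OF this, of N] show False
      using \<epsilon>(1) by (simp add: f_def b)
  qed
  then show ?thesis
    using schur[of 0] schur[of \<epsilon>] \<epsilon>(1) interp by (intro bexI[of _ "ball_function (f 0)"] bexI[of _ "ball_function (f \<epsilon>)"]) auto
qed

text \<open>Both solutions satisfy the same convolution equation, whose right factor is a nonzero sequence.\<close>

lemma singular_pick_unique: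
  fixes p s :: "'n::finite \<Rightarrow> quat"
  assumes p: "\<And>i. norm (p i) < 1"
    and indep: "\<And>c. node_seq p (\<lambda>_. 1) c = (\<lambda>_. 0) \<Longrightarrow> c = 0"
    and c: "c \<noteq> 0" "node_norm p s c = node_norm p (\<lambda>_. 1) c"
    and S: "S \<in> slice_schur_class" "\<And>i. S (p i) = s i"
    and S': "S' \<in> slice_schur_class" "\<And>i. S' (p i) = s i"
  shows "S = S'"
proof -
  obtain a where a: "\<And>p. norm p < 1 \<Longrightarrow> (\<lambda>k. p ^ k * a k) sums S p"
    "\<And>K g. (\<Sum>k<K. (norm (star_product a g k))\<^sup>2) \<le> (\<Sum>k<K. (norm (g k))\<^sup>2)"
    using schur_class_power_series[OF S(1)] by blast
  obtain a' where a': "\<And>p. norm p < 1 \<Longrightarrow> (\<lambda>k. p ^ k * a' k) sums S' p"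
    "\<And>K g. (\<Sum>k<K. (norm (star_product a' g k))\<^sup>2) \<le> (\<Sum>k<K. (norm (g k))\<^sup>2)"
    using schur_class_power_series[OF S'(1)] by blast
  have "(\<lambda>m. p j ^ m * a m) sums s j" "(\<lambda>m. p j ^ m * a' m) sums s j" for j
    using a(1)[OF p[of j]] a'(1)[OF p[of j]] by (simp_all add: S(2) S'(2))
  then have "star_product a (node_seq p s c) = node_seq p (\<lambda>_. 1) c" "star_product a' (node_seq p s c) = node_seq p (\<lambda>_. 1) c"
    using star_product_node_seq[of p a s c] star_product_node_seq[of p a' s c] p a(2) a'(2) c(2) by blast+
  then have eq: "star_product a (node_seq p s c) = star_product a' (node_seq p s c)"
    by simp
  have "node_seq p s c \<noteq> (\<lambda>_. 0)"
  proof
    assume "node_seq p s c = (\<lambda>_. 0)"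
    then have "node_norm p (\<lambda>_. 1) c = 0"
      using c(2) by (simp add: node_norm_def)
    then have "node_seq p (\<lambda>_. 1) c = (\<lambda>_. 0)"
      unfolding node_norm_def using suminf_eq_zero_iff[OF summable_node_seq_sq[where p = p, OF p]] by (simp add: fun_eq_iff)
    then show False
      using indep c(1) by blast
  qed
  with eq have "a = a'"
    by (rule star_product_right_cancel)
  show "S = S'"
  proof (rule PiE_ext)
    show "S \<in> ball 0 1 \<rightarrow>\<^sub>E cball 0 1" "S' \<in> ball 0 1 \<rightarrow>\<^sub>E cball 0 1"
      using S(1) S'(1) by (simp_all add: slice_schur_class_def)
    show "S q = S' q" if "q \<in> ball 0 1" for q
      using a(1)[of q] a'(1)[of q] that \<open>a = a'\<close> sums_unique2 by fastforce
  qed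
qed

theorem theorem1p5:
  fixes p s :: "'n::finite \<Rightarrow> quat"
  assumes "\<And>i. p i \<in> ball 0 1"
    and "inj p"
    and "\<And>i j k. i \<noteq> j \<Longrightarrow> i \<noteq> k \<Longrightarrow> j \<noteq> k \<Longrightarrow> \<not> (\<exists>q. {p i, p j, p k} \<subseteq> two_sphere q)"
  shows "(\<exists>!S. S \<in> slice_schur_class \<and> (\<forall>i. S (p i) = s i)) \<longleftrightarrow>
         psd_quat_matrix (pick_matrix p s) \<and> \<not> invertible (pick_matrix p s)"
proof -
  have p: "norm (p i) < 1" for i
    using assms(1) by simp
  have psd_iff: "psd_quat_matrix (pick_matrix p s) \<longleftrightarrow> (\<forall>c. node_norm p s c \<le> node_norm p (\<lambda>_. 1) c)"
    by (rule psd_pick_matrix_iff[OF p])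
  have hermitian_form: "hermitian_form (pick_matrix p s) c = 0 \<longleftrightarrow> node_norm p s c = node_norm p (\<lambda>_. 1) c" for c
    unfolding hermitian_form_pick_matrix[where p = p, OF p] of_real_eq_0_iff by auto
  have indep: "c = 0" if "node_seq p (\<lambda>_. 1) c = (\<lambda>_. 0)" for c
  proof (rule node_seq_eq_0_imp[OF \<open>inj p\<close> _ that])
    fix i j k :: 'n assume ne: "i \<noteq> j" "i \<noteq> k" "j \<noteq> k"
    have "same_sphere (p i) (p i)"
      by (simp add: same_sphere_def)
    then show "\<not> (same_sphere (p j) (p i) \<and> same_sphere (p k) (p i))"
      using assms(3)[OF ne] same_sphere_imp_quat_equiv by (auto simp: two_sphere_def)
  qed
  show ?thesis
  proof
    assume ex1: "\<exists>!S. S \<in> slice_schur_class \<and> (\<forall>i. S (p i) = s i)"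
    then obtain S where S: "S \<in> slice_schur_class" "\<And>i. S (p i) = s i"
      by blast
    obtain a where a: "\<And>p. norm p < 1 \<Longrightarrow> (\<lambda>k. p ^ k * a k) sums S p"
      "\<And>K g. (\<Sum>k<K. (norm (star_product a g k))\<^sup>2) \<le> (\<Sum>k<K. (norm (g k))\<^sup>2)"
      using schur_class_power_series[OF S(1)] by blast
    have "(\<lambda>m. p j ^ m * a m) sums s j" for j
      using a(1)[OF p[of j]] by (simp add: S(2))
    then have le: "node_norm p s c \<le> node_norm p (\<lambda>_. 1) c" for c
      using node_norm_le[of p a s c] p a(2) by blast
    then have psd: "psd_quat_matrix (pick_matrix p s)"
      by (simp add: psd_iff)
    moreover have "\<not> invertible (pick_matrix p s)"
    proof
      assume "invertible (pick_matrix p s)"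
      then have "node_norm p s c < node_norm p (\<lambda>_. 1) c" if "c \<noteq> 0" for c
        using that le[of c] unfolding psd_invertible_iff_definite[OF psd] hermitian_form by (simp add: less_le)
      from strict_pick_not_unique[OF p this] ex1 show False
        by blast
    qed
    ultimately show "psd_quat_matrix (pick_matrix p s) \<and> \<not> invertible (pick_matrix p s)" ..
  next
    assume "psd_quat_matrix (pick_matrix p s) \<and> \<not> invertible (pick_matrix p s)"
    then have psd: "psd_quat_matrix (pick_matrix p s)" and "\<not> invertible (pick_matrix p s)"
      by blast+
    then obtain c where c: "c \<noteq> 0" "node_norm p s c = node_norm p (\<lambda>_. 1) c"
      unfolding psd_invertible_iff_definite[OF psd] hermitian_form by blast
    obtain a where a: "\<And>k. norm (a k) \<le> 1" "\<And>p. norm p < 1 \<Longrightarrow> norm (\<Sum>k. p ^ k * a k) \<le> 1"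
      "\<And>i. (\<Sum>k. p i ^ k * a k) = s i"
      using psd_pick_matrix_imp_interpolant[OF p psd] by blast
    have "ball_function a \<in> slice_schur_class"
      by (rule ball_function_schur[of a 1]) (use a in auto)
    moreover have "ball_function a (p i) = s i" for i
      using p[of i] a(3) by (simp add: ball_function_def)
    ultimately show "\<exists>!S. S \<in> slice_schur_class \<and> (\<forall>i. S (p i) = s i)"
      using singular_pick_unique[OF p indep c] by blast
  qed
qed

end
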